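(* Let $U=(U_{ij}:i,j\in I)$ be an ultrametric matrix satisfying (H1)–(H4), the chain $\widetilde X$ of its minimal tree matrix extension being transient. Then there exists a matrix $Q:I\times I\to\mathbb R$ such that $QU=UQ=-\mathbb I_I$ (the identity matrix on $I$). Moreover $Q_{ij}\neq0$ if and only if $j\in\mathcal V^*(i)$, and $$Q_{ij}=\widetilde Q_{ij}+\sum_{\tilde k\in\widetilde I\setminus I}\widetilde Q_{i\tilde k}\,\mathbb P_{\tilde k}(\widetilde X_\tau=j),\qquad i,j\in I.$$ For $i\neq j$ this formula takes the form $$Q_{ij}=\widetilde Q_{ij}\ \text{ if }(i,j)\in\widetilde{\mathcal T},\qquad Q_{ij}=\widetilde Q_{i\tilde k}\,\mathbb P_{\tilde k}(\widetilde X_\tau=j)\ \text{ if }(i,j)\notin\widetilde{\mathcal T},\ j\in\mathcal V^*(i),$$ where $\tilde k\in\widetilde I\setminus I$ is the unique neighbour of $i$ in $\widetilde{\mathcal T}$ that belongs to $geod(i,j)$.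
   Context: Ultrametric matrix. $I$ is countable; $U$ is real, symmetric and satisfies $U_{ij}\ge\min\{U_{ik},U_{kj}\}$ for all $i,j,k\in I$. (H1): if $i\ne j$ then $U_{ik}\ne U_{jk}$ for some $k\in I$. (H2): $\mathcal W=\{U_{ij}:i,j\in I\}\subset(0,\infty)$ has no finite accumulation point; write $\mathcal W=\{w_n:n\in\mathbb N\}$ with $0<w_0<w_1<\cdots$, and $w_{-1}=0$. For $w\in\mathcal W$ let $J(w)=\{i\in I:U_{ii}\ge w\}$, and for $i,j\in J(w)$ put $i\equiv_wj$ iff $U_{ij}\ge w$ (an equivalence relation on $J(w)$); $E^w$ denotes an equivalence class and $E^w_i$ the class of $i$. (H3): for every $w\in\mathcal W$ the number of equivalence classes of $\equiv_w$ in $J(w)$ is finite. Minimal tree extension. $\widetilde I=\{(E^w,w): E^w\in J(w)/\!\equiv_w,\ w\in\mathcal W\}$; $I$ is identified with a subset of $\widetilde I$ via the injection $i\mapsto(E^{U_{ii}}_i,U_{ii})$. Two points $(E^u,u),(E^v,v)$ are neighbours, i.e. linked in $\widetilde{\mathcal T}$, iff $\{u,v\}=\{w_n,w_{n+1}\}$ for some $n$ and $E^u\cap E^v\ne\emptyset$. Then $(\widetilde I,\widetilde{\mathcal T})$ is a locally finite tree, rooted at the unique point $\tilde r$ with second coordinate $w_0$; $(E^{w_n},w_n)$ has level $n$. Write $|\tilde\imath|$ for the level, $\tilde\imath^-$ for the predecessor ($\tilde\imath\neq\tilde r$), $S_{\tilde\imath}$ for the set of successors, $geod(\tilde\imath,\tilde\jmath)$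 for the set of vertices of the geodesic joining two points. The matrix $\widetilde U_{\tilde\imath\tilde\jmath}=w_{|\tilde\imath\wedge\tilde\jmath|}$ ($\tilde\imath\wedge\tilde\jmath$ the common vertex, farthest from $\tilde r$, of the geodesics from $\tilde r$) is a tree matrix extending $U$. Its $q$-matrix is $\widetilde Q_{\tilde\imath\tilde\imath^-}=\widetilde Q_{\tilde\imath^-\tilde\imath}=(w_{|\tilde\imath|}-w_{|\tilde\imath|-1})^{-1}$ for $\tilde\imath\ne\tilde r$, $\widetilde Q_{\tilde\imath\tilde\imath}=-\big((w_{|\tilde\imath|}-w_{|\tilde\imath|-1})^{-1}+|S_{\tilde\imath}|(w_{|\tilde\imath|+1}-w_{|\tilde\imath|})^{-1}\big)$, and $0$ otherwise. Chain. $\widetilde X$ is the minimal continuous-time Markov chain on $\widetilde I$ with $q$-matrix $\widetilde Q$, absorbed from $\tilde r$ at rate $1/w_0$ in an extra state $\partial_{\tilde r}$; $\tilde\zeta$ is its lifetime. When not absorbed it converges a.s., as $t\uparrow\tilde\zeta$, to a point of the boundary $\widetilde\partial_\infty$ (the set of infinite rays of $\widetilde I$ from $\tilde r$). $\widetilde X$ is assumed transient: from $\tilde r$ it has positive probability of ending in $\widetilde\partial_\infty$. Let $\tau=\inf\{t>0:\widetilde X_t\in I\cup\{\partial_{\tilde r}\}\}\wedge\tilde\zeta$. (H4): for all $\tilde\jmath\in\widetilde I\setminus I$, $\mathbb P_{\tilde\jmath}\{\widetilde X_\tau\in I\cup\{\partial_{\tilde r}\}\}=1$. $U$-neighbours.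 For $i\in I$, $\mathcal V(i)=\{j\in I:j\ne i,\ geod(i,j)\cap I=\{i,j\}\}$ (geodesic in $\widetilde{\mathcal T}$) and $\mathcal V^*(i)=\mathcal V(i)\cup\{i\}$. *)

theory Defs
  imports "HOL-Probability.Probability"
begin

section \<open>Ultrametric matrices\<close>

definition ultrametric_matrix :: "'a set \<Rightarrow> ('a \<Rightarrow> 'a \<Rightarrow> real) \<Rightarrow> bool" where
  "ultrametric_matrix I U \<longleftrightarrow> countable I \<and>
     (\<forall>i\<in>I. \<forall>j\<in>I. U i j = U j i) \<and>
     (\<forall>i\<in>I. \<forall>j\<in>I. \<forall>k\<in>I. U i j \<ge> min (U i k) (U k j))"

definition distinct_rows :: "'a set \<Rightarrow> ('a \<Rightarrow> 'a \<Rightarrow> real) \<Rightarrow> bool" where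
  "distinct_rows I U \<longleftrightarrow> (\<forall>i\<in>I. \<forall>j\<in>I. i \<noteq> j \<longrightarrow> (\<exists>k\<in>I. U i k \<noteq> U j k))"

definition weights :: "'a set \<Rightarrow> ('a \<Rightarrow> 'a \<Rightarrow> real) \<Rightarrow> real set" where
  "weights I U = {U i j | i j. i \<in> I \<and> j \<in> I}"

definition discrete_weights :: "'a set \<Rightarrow> ('a \<Rightarrow> 'a \<Rightarrow> real) \<Rightarrow> (nat \<Rightarrow> real) \<Rightarrow> bool" where
  "discrete_weights I U w \<longleftrightarrow>
     weights I U \<subseteq> {0<..} \<and> (\<forall>x. \<not> x islimpt weights I U) \<and>
     strict_mono w \<and> range w = weights I U"

definition upper :: "'a set \<Rightarrow> ('a \<Rightarrow> 'a \<Rightarrow> real) \<Rightarrow> real \<Rightarrow> 'a set" where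
  "upper I U u = {i \<in> I. U i i \<ge> u}"

definition upper_rel :: "'a set \<Rightarrow> ('a \<Rightarrow> 'a \<Rightarrow> real) \<Rightarrow> real \<Rightarrow> ('a \<times> 'a) set" where
  "upper_rel I U u = {(i, j). i \<in> upper I U u \<and> j \<in> upper I U u \<and> U i j \<ge> u}"

definition finite_classes :: "'a set \<Rightarrow> ('a \<Rightarrow> 'a \<Rightarrow> real) \<Rightarrow> bool" where
  "finite_classes I U \<longleftrightarrow> (\<forall>u\<in>weights I U. finite (upper I U u // upper_rel I U u))"


section \<open>The minimal tree extension\<close>

type_synonym 'a vertex = "'a set \<times> real"

definition tree :: "'a set \<Rightarrow> ('a \<Rightarrow> 'a \<Rightarrow> real) \<Rightarrow> 'a vertex set" where
  "tree I U = {(E, u). u \<in> weights I U \<and> E \<in> upper I U u // upper_rel I U u}"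

text \<open>The injection identifying an index with a tree vertex.\<close>

definition emb :: "'a set \<Rightarrow> ('a \<Rightarrow> 'a \<Rightarrow> real) \<Rightarrow> 'a \<Rightarrow> 'a vertex" where
  "emb I U i = (upper_rel I U (U i i) `` {i}, U i i)"

definition linked ::
  "'a set \<Rightarrow> ('a \<Rightarrow> 'a \<Rightarrow> real) \<Rightarrow> (nat \<Rightarrow> real) \<Rightarrow> 'a vertex \<Rightarrow> 'a vertex \<Rightarrow> bool" where
  "linked I U w x y \<longleftrightarrow> x \<in> tree I U \<and> y \<in> tree I U \<and>
     (\<exists>n. {snd x, snd y} = {w n, w (Suc n)}) \<and> fst x \<inter> fst y \<noteq> {}"

definition root :: "'a set \<Rightarrow> ('a \<Rightarrow> 'a \<Rightarrow> real) \<Rightarrow> (nat \<Rightarrow> real) \<Rightarrow> 'a vertex" where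
  "root I U w = (THE x. x \<in> tree I U \<and> snd x = w 0)"

definition level :: "(nat \<Rightarrow> real) \<Rightarrow> 'a vertex \<Rightarrow> nat" where
  "level w x = (THE n. w n = snd x)"

definition successors ::
  "'a set \<Rightarrow> ('a \<Rightarrow> 'a \<Rightarrow> real) \<Rightarrow> (nat \<Rightarrow> real) \<Rightarrow> 'a vertex \<Rightarrow> 'a vertex set" where
  "successors I U w x = {y. linked I U w x y \<and> level w y = Suc (level w x)}"

text \<open>In a tree the geodesic between two vertices is the only path joining them without
  repeated vertices; \<open>geod\<close> is its vertex set.\<close>

definition simple_path ::
  "'a set \<Rightarrow> ('a \<Rightarrow> 'a \<Rightarrow> real) \<Rightarrow> (nat \<Rightarrow> real) \<Rightarrow> 'a vertex \<Rightarrow> 'a vertex \<Rightarrow> 'a vertex list \<Rightarrow> bool" where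
  "simple_path I U w x y p \<longleftrightarrow> p \<noteq> [] \<and> hd p = x \<and> last p = y \<and>
     set p \<subseteq> tree I U \<and> distinct p \<and> successively (linked I U w) p"

definition geod ::
  "'a set \<Rightarrow> ('a \<Rightarrow> 'a \<Rightarrow> real) \<Rightarrow> (nat \<Rightarrow> real) \<Rightarrow> 'a vertex \<Rightarrow> 'a vertex \<Rightarrow> 'a vertex set" where
  "geod I U w x y = set (THE p. simple_path I U w x y p)"

definition U_neighbours ::
  "'a set \<Rightarrow> ('a \<Rightarrow> 'a \<Rightarrow> real) \<Rightarrow> (nat \<Rightarrow> real) \<Rightarrow> 'a \<Rightarrow> 'a set" where
  "U_neighbours I U w i = {j \<in> I. j \<noteq> i \<and>
     geod I U w (emb I U i) (emb I U j) \<inter> emb I U ` I = {emb I U i, emb I U j}}"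

definition weight_gap :: "(nat \<Rightarrow> real) \<Rightarrow> nat \<Rightarrow> real" where
  "weight_gap w n = w n - (if n = 0 then 0 else w (n - 1))"

text \<open>Here \<open>x\<close> is the predecessor of \<open>y\<close> iff \<open>y \<in> successors I U w x\<close>.\<close>

definition tree_Q ::
  "'a set \<Rightarrow> ('a \<Rightarrow> 'a \<Rightarrow> real) \<Rightarrow> (nat \<Rightarrow> real) \<Rightarrow> 'a vertex \<Rightarrow> 'a vertex \<Rightarrow> real" where
  "tree_Q I U w x y =
     (if x = y then - (1 / weight_gap w (level w x)
          + real (card (successors I U w x)) * (1 / weight_gap w (Suc (level w x))))
      else if x \<in> successors I U w y then 1 / weight_gap w (level w x)
      else if y \<in> successors I U w x then 1 / weight_gap w (level w y)
      else 0)"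


section \<open>Minimal continuous-time Markov chains\<close>

text \<open>
  \<open>R\<close> is a stable conservative q-matrix on the countable state set \<open>A\<close>.  The minimal chain is
  given by its jump chain \<open>Y\<close> and its holding times \<open>Z\<close>: under \<open>P x\<close> the chain \<open>Y\<close> is Markov
  with the transition matrix \<open>jump_prob R\<close> and starts at \<open>x\<close>, and given \<open>Y\<close> the \<open>Z n\<close> are
  independent and exponential of rate \<open>- R (Y n) (Y n)\<close> (almost surely infinite if that rate
  is \<open>0\<close>).  The law of the pair is specified on cylinder events.
\<close>

definition jump_prob :: "('s \<Rightarrow> 's \<Rightarrow> real) \<Rightarrow> 's \<Rightarrow> 's \<Rightarrow> real" where
  "jump_prob R x y =
     (if R x x = 0 then (if x = y then 1 else 0)
      else if x = y then 0 else R x y / (- R x x))"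

definition minimal_chain ::
  "'s set \<Rightarrow> ('s \<Rightarrow> 's \<Rightarrow> real) \<Rightarrow> ('s \<Rightarrow> 'w measure) \<Rightarrow>
   (nat \<Rightarrow> 'w \<Rightarrow> 's) \<Rightarrow> (nat \<Rightarrow> 'w \<Rightarrow> ennreal) \<Rightarrow> bool" where
  "minimal_chain A R P Y Z \<longleftrightarrow>
     (\<forall>x\<in>A. prob_space (P x) \<and>
        (\<forall>n. Y n \<in> measurable (P x) (count_space A)) \<and>
        (\<forall>n. Z n \<in> borel_measurable (P x)) \<and>
        (\<forall>n y s. (\<forall>k\<le>n. y k \<in> A \<and> 0 \<le> s k) \<longrightarrow>
           measure (P x) {\<omega> \<in> space (P x). \<forall>k\<le>n. Y k \<omega> = y k \<and> ennreal (s k) < Z k \<omega>} =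
             (if y 0 = x then 1 else 0) * (\<Prod>k<n. jump_prob R (y k) (y (Suc k))) *
             (\<Prod>k\<le>n. exp (R (y k) (y k) * s k))))"

definition lifetime :: "(nat \<Rightarrow> 'w \<Rightarrow> ennreal) \<Rightarrow> 'w \<Rightarrow> ennreal" where
  "lifetime Z \<omega> = (\<Sum>n. Z n \<omega>)"

text \<open>The chain at time \<open>t\<close>: the state \<open>Y n \<omega>\<close> for \<open>t\<close> between the \<open>n\<close>-th and the next jump time,
  and \<open>None\<close> from the lifetime on (including \<open>t = \<infinity>\<close>).\<close>

definition chain_at ::
  "(nat \<Rightarrow> 'w \<Rightarrow> 's) \<Rightarrow> (nat \<Rightarrow> 'w \<Rightarrow> ennreal) \<Rightarrow> ennreal \<Rightarrow> 'w \<Rightarrow> 's option" where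
  "chain_at Y Z t \<omega> =
     (if t < lifetime Z \<omega> then Some (Y (LEAST n. t < (\<Sum>k\<le>n. Z k \<omega>)) \<omega>) else None)"

definition hitting_time ::
  "'s set \<Rightarrow> (nat \<Rightarrow> 'w \<Rightarrow> 's) \<Rightarrow> (nat \<Rightarrow> 'w \<Rightarrow> ennreal) \<Rightarrow> 'w \<Rightarrow> ennreal" where
  "hitting_time B Y Z \<omega> =
     min (Inf {t. 0 < t \<and> chain_at Y Z t \<omega> \<in> Some ` B}) (lifetime Z \<omega>)"


section \<open>The chain on the tree\<close>

datatype 'v state = Vertex 'v | Absorbed

definition tree_states :: "'a set \<Rightarrow> ('a \<Rightarrow> 'a \<Rightarrow> real) \<Rightarrow> 'a vertex state set" where
  "tree_states I U = Vertex ` tree I U \<union> {Absorbed}"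

fun tree_rates ::
  "'a set \<Rightarrow> ('a \<Rightarrow> 'a \<Rightarrow> real) \<Rightarrow> (nat \<Rightarrow> real) \<Rightarrow> 'a vertex state \<Rightarrow> 'a vertex state \<Rightarrow> real" where
  "tree_rates I U w (Vertex x) (Vertex y) = tree_Q I U w x y"
| "tree_rates I U w (Vertex x) Absorbed = (if x = root I U w then 1 / w 0 else 0)"
| "tree_rates I U w Absorbed _ = 0"

definition stop_set :: "'a set \<Rightarrow> ('a \<Rightarrow> 'a \<Rightarrow> real) \<Rightarrow> 'a vertex state set" where
  "stop_set I U = Vertex ` emb I U ` I \<union> {Absorbed}"

text \<open>The value \<open>X\<^sub>\<tau>\<close>; it is \<open>None\<close> on paths that reach their lifetime without meeting
  \<open>stop_set I U\<close>.\<close>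

definition stopped_value ::
  "'a set \<Rightarrow> ('a \<Rightarrow> 'a \<Rightarrow> real) \<Rightarrow> (nat \<Rightarrow> 'w \<Rightarrow> 'a vertex state) \<Rightarrow> (nat \<Rightarrow> 'w \<Rightarrow> ennreal) \<Rightarrow>
   'w \<Rightarrow> 'a vertex state option" where
  "stopped_value I U Y Z \<omega> = chain_at Y Z (hitting_time (stop_set I U) Y Z \<omega>) \<omega>"

definition hit_prob ::
  "'a set \<Rightarrow> ('a \<Rightarrow> 'a \<Rightarrow> real) \<Rightarrow> ('a vertex state \<Rightarrow> 'w measure) \<Rightarrow>
   (nat \<Rightarrow> 'w \<Rightarrow> 'a vertex state) \<Rightarrow> (nat \<Rightarrow> 'w \<Rightarrow> ennreal) \<Rightarrow> 'a vertex \<Rightarrow> 'a \<Rightarrow> real" where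
  "hit_prob I U P Y Z k j =
     measure (P (Vertex k))
       {\<omega> \<in> space (P (Vertex k)). stopped_value I U Y Z \<omega> = Some (Vertex (emb I U j))}"

definition stops_surely ::
  "'a set \<Rightarrow> ('a \<Rightarrow> 'a \<Rightarrow> real) \<Rightarrow> ('a vertex state \<Rightarrow> 'w measure) \<Rightarrow>
   (nat \<Rightarrow> 'w \<Rightarrow> 'a vertex state) \<Rightarrow> (nat \<Rightarrow> 'w \<Rightarrow> ennreal) \<Rightarrow> bool" where
  "stops_surely I U P Y Z \<longleftrightarrow>
     (\<forall>k \<in> tree I U - emb I U ` I.
        measure (P (Vertex k))
          {\<omega> \<in> space (P (Vertex k)). stopped_value I U Y Z \<omega> \<in> Some ` stop_set I U} = 1)"

definition ray ::
  "'a set \<Rightarrow> ('a \<Rightarrow> 'a \<Rightarrow> real) \<Rightarrow> (nat \<Rightarrow> real) \<Rightarrow> (nat \<Rightarrow> 'a vertex) \<Rightarrow> bool" where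
  "ray I U w \<xi> \<longleftrightarrow> \<xi> 0 = root I U w \<and> (\<forall>n. \<xi> (Suc n) \<in> successors I U w (\<xi> n))"

text \<open>A path tends to the boundary point \<open>\<xi>\<close> iff, for every \<open>n\<close>, it finally stays (just before its
  lifetime) in the branch of the tree hanging from \<open>\<xi> n\<close>.\<close>

definition tends_to_ray ::
  "'a set \<Rightarrow> ('a \<Rightarrow> 'a \<Rightarrow> real) \<Rightarrow> (nat \<Rightarrow> real) \<Rightarrow> (nat \<Rightarrow> 'w \<Rightarrow> 'a vertex state) \<Rightarrow>
   (nat \<Rightarrow> 'w \<Rightarrow> ennreal) \<Rightarrow> 'w \<Rightarrow> (nat \<Rightarrow> 'a vertex) \<Rightarrow> bool" where
  "tends_to_ray I U w Y Z \<omega> \<xi> \<longleftrightarrow>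
     (\<forall>n. \<exists>t < lifetime Z \<omega>. \<forall>s. t \<le> s \<and> s < lifetime Z \<omega> \<longrightarrow>
        (\<exists>y \<in> tree I U. \<xi> n \<in> geod I U w (root I U w) y \<and> chain_at Y Z s \<omega> = Some (Vertex y)))"

definition transient ::
  "'a set \<Rightarrow> ('a \<Rightarrow> 'a \<Rightarrow> real) \<Rightarrow> (nat \<Rightarrow> real) \<Rightarrow> ('a vertex state \<Rightarrow> 'w measure) \<Rightarrow>
   (nat \<Rightarrow> 'w \<Rightarrow> 'a vertex state) \<Rightarrow> (nat \<Rightarrow> 'w \<Rightarrow> ennreal) \<Rightarrow> bool" where
  "transient I U w P Y Z \<longleftrightarrow>
     measure (P (Vertex (root I U w)))
       {\<omega> \<in> space (P (Vertex (root I U w))). \<exists>\<xi>. ray I U w \<xi> \<and> tends_to_ray I U w Y Z \<omega> \<xi>} > 0"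

end

theory Submission
  imports Defs
begin

text \<open>
  For \<open>j \<in> I\<close> the column \<open>potential j\<close> of the tree matrix is bounded, and the tree
  \<open>q\<close>-matrix maps it to minus the indicator of \<open>j\<close>.  It is therefore harmonic off \<open>I\<close>, and since
  the chain stops almost surely, its value at \<open>x \<notin> I\<close> is the mean of its boundary values under
  the hitting distribution from \<open>x\<close>.  With \<open>Q\<close> defined by the asserted formula this turns the
  tree identity into \<open>Q U = -1\<close>.  For \<open>i \<noteq> j\<close>, \<open>Q i j\<close> is the total weight of the paths from \<open>i\<close> to
  \<open>j\<close> whose interior avoids \<open>I\<close>; these weights are invariant under reversal, so \<open>Q\<close> is symmetric
  and \<open>U Q = -1\<close> follows.  The positions of the nonzero entries are read off the same expansion,
  because every such path contains the geodesic.
\<close>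

section \<open>Jump chains and hitting times\<close>

text \<open>The tree identity is conservation of flux. Along the way from the root to
  \<open>j\<close> the potential grows across each edge by the reciprocal of its conductance, so one
  unit flows in and one out at every vertex before \<open>j\<close>; elsewhere the potential is
  locally constant. The absorption rate \<open>1 / w 0\<close> is the conductance of one more edge
  below level 0, with potential 0 at its end, so \<open>Absorbed\<close> is a boundary point of
  value 0 and never shows up in the sums. Two obstacles shape the rest. The chain runs in continuous
  time and may explode, while the argument counts steps: almost surely the holding times are
  positive, and finite outside \<open>Absorbed\<close>, so the value at the hitting time is decided
  by finitely many jumps. Moreover \<open>I\<close> may be infinite, so a row of \<open>Q U\<close>
  is a double series over hit indices and step numbers. Its terms are nonnegative and may be
  rearranged, and (H4) enters as the convergence to 0 of the probability of \<open>n\<close> steps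
  without stopping, which bounds the error of the expansion after \<open>n\<close> steps.\<close>

lemma chain_at_eq_Some:
  fixes Z :: "nat \<Rightarrow> 'w \<Rightarrow> ennreal"
  shows "chain_at Y Z t \<omega> = Some v \<longleftrightarrow>
    (\<exists>n. (\<Sum>k<n. Z k \<omega>) \<le> t \<and> t < (\<Sum>k<Suc n. Z k \<omega>) \<and> v = Y n \<omega>)" (is "?L \<longleftrightarrow> ?R")
proof
  let ?S = "\<lambda>n. \<Sum>k<n. Z k \<omega>"
  have mono: "?S m \<le> ?S n" if "m \<le> n" for m n
    using that by (intro sum_mono2) auto
  have life: "lifetime Z \<omega> = (SUP n. ?S n)"
    unfolding lifetime_def by (rule suminf_eq_SUP)
  { assume ?L
    then have t: "t < lifetime Z \<omega>" and v: "v = Y (LEAST n. t < ?S (Suc n)) \<omega>"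
      by (auto simp: chain_at_def lessThan_Suc_atMost split: if_splits)
    from t obtain m where "t < ?S m" unfolding life less_SUP_iff by blast
    then have "t < ?S (Suc m)" using mono[of m "Suc m"] by (rule less_le_trans) simp
    then have 1: "t < ?S (Suc (LEAST n. t < ?S (Suc n)))" by (rule LeastI)
    have 2: "?S (LEAST n. t < ?S (Suc n)) \<le> t"
    proof (cases "LEAST n. t < ?S (Suc n)")
      case (Suc m)
      then have "\<not> t < ?S (Suc m)" using not_less_Least[of m "\<lambda>n. t < ?S (Suc n)"] by simp
      then show ?thesis unfolding Suc by simp
    qed simp
    show ?R using 1 2 v by blast }
  { assume ?R
    then obtain n where n: "?S n \<le> t" "t < ?S (Suc n)" "v = Y n \<omega>" by blast
    have "(LEAST n. t < ?S (Suc n)) = n"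
    proof (rule Least_equality)
      show "t < ?S (Suc n)" by fact
      fix m assume "t < ?S (Suc m)"
      show "n \<le> m"
      proof (rule ccontr)
        assume "\<not> n \<le> m"
        then have "?S (Suc m) \<le> ?S n" by (intro mono) simp
        with n(1) \<open>t < ?S (Suc m)\<close> show False by order
      qed
    qed
    moreover have "t < lifetime Z \<omega>" unfolding life less_SUP_iff using n(2) by blast
    ultimately show ?L using n(3) by (simp add: chain_at_def lessThan_Suc_atMost[symmetric]) }
qed

text \<open>States occupied for a time of length \<open>0\<close> are invisible to the chain; apart from them, the
  value at the hitting time is the first state of the jump chain in the target.\<close>

lemma chain_at_hitting_time:
  fixes Z :: "nat \<Rightarrow> 'w \<Rightarrow> ennreal"
  defines "S \<equiv> \<lambda>\<omega> n. \<Sum>k<n. Z k \<omega>"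
  shows "chain_at Y Z (hitting_time B Y Z \<omega>) \<omega> = Some v \<longleftrightarrow>
    (\<exists>n. v = Y n \<omega> \<and> v \<in> B \<and> S \<omega> n < S \<omega> (Suc n) \<and>
      (\<forall>m<n. \<not> (Y m \<omega> \<in> B \<and> S \<omega> m < S \<omega> (Suc m))))"
proof -
  let ?S = "S \<omega>"
  have mono: "?S m \<le> ?S n" if "m \<le> n" for m n
    using that unfolding S_def by (intro sum_mono2) auto
  have life: "lifetime Z \<omega> = (SUP n. ?S n)"
    unfolding lifetime_def S_def by (rule suminf_eq_SUP)
  define good where "good n \<longleftrightarrow> Y n \<omega> \<in> B \<and> ?S n < ?S (Suc n)" for n
  define T where "T = {t. 0 < t \<and> chain_at Y Z t \<omega> \<in> Some ` B}"
  have T: "t \<in> T \<longleftrightarrow> 0 < t \<and> (\<exists>n. ?S n \<le> t \<and> t < ?S (Suc n) \<and> Y n \<omega> \<in> B)" for t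
    unfolding T_def S_def by (auto simp: image_iff chain_at_eq_Some)
  have hit: "hitting_time B Y Z \<omega> = min (Inf T) (lifetime Z \<omega>)"
    by (simp add: hitting_time_def T_def)
  show ?thesis
  proof (cases "\<exists>n. good n")
    case True
    define N where "N = (LEAST n. good n)"
    have N: "good N" unfolding N_def using True by (rule LeastI_ex)
    have less: "\<not> good m" if "m < N" for m using that unfolding N_def by (rule not_less_Least)
    have "Inf T = ?S N"
    proof (rule antisym)
      show "?S N \<le> Inf T"
      proof (rule Inf_greatest)
        fix t assume "t \<in> T"
        then obtain n where n: "?S n \<le> t" "t < ?S (Suc n)" "Y n \<omega> \<in> B" unfolding T by blast
        then have "good n" unfolding good_def by (auto intro: le_less_trans)
        then have "?S N \<le> ?S n" using less by (intro mono) (meson not_less)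
        then show "?S N \<le> t" using n(1) by order
      qed
      show "Inf T \<le> ?S N"
      proof (rule ccontr)
        assume "\<not> Inf T \<le> ?S N"
        then have "?S N < min (Inf T) (?S (Suc N))" using N by (simp add: good_def)
        \<comment> \<open>The time \<open>?S N\<close> need not lie in \<open>T\<close>, whose
          members are strictly positive; an intermediate time of the same sojourn serves
          instead.\<close>
        then obtain t where t: "?S N < t" "t < min (Inf T) (?S (Suc N))" using dense by blast
        then have "t \<in> T" using N unfolding T good_def by (auto intro: le_less_trans less_imp_le)
        then have "Inf T \<le> t" by (rule Inf_lower)
        then show False using t(2) by (metis min_less_iff_conj not_less)
      qed
    qed
    moreover have SN: "?S N < ?S (Suc N)" using N by (simp add: good_def)
    moreover have "?S (Suc N) \<le> lifetime Z \<omega>" unfolding life by (rule SUP_upper) simp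
    ultimately have "hitting_time B Y Z \<omega> = ?S N" unfolding hit by (simp add: min_absorb1 less_imp_le order.strict_trans2)
    moreover have "chain_at Y Z (?S N) \<omega> = Some (Y N \<omega>)"
      unfolding chain_at_eq_Some using SN by (auto simp: S_def)
    ultimately have "chain_at Y Z (hitting_time B Y Z \<omega>) \<omega> = Some v \<longleftrightarrow> v = Y N \<omega>" by auto
    moreover have "(\<exists>n. v = Y n \<omega> \<and> v \<in> B \<and> ?S n < ?S (Suc n) \<and> (\<forall>m<n. \<not> good m))
      \<longleftrightarrow> v = Y N \<omega>"
    proof safe
      fix n assume "Y n \<omega> \<in> B" "?S n < ?S (Suc n)" "\<forall>m<n. \<not> good m"
      then have "n = N" using N less by (metis good_def linorder_neqE_nat)
      then show "Y n \<omega> = Y N \<omega>" by simp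
    qed (use N less in \<open>auto simp: good_def\<close>)
    ultimately show ?thesis by (simp add: good_def)
  next
    case False
    \<comment> \<open>The infimum of the empty set is infinite, so the hitting time is the lifetime,
      where \<open>chain_at\<close> is \<open>None\<close>.\<close>
    then have "T = {}" unfolding good_def T by (auto simp: T set_eq_iff intro: le_less_trans)
    then have "hitting_time B Y Z \<omega> = lifetime Z \<omega>" unfolding hit by simp
    then show ?thesis using False by (auto simp: chain_at_def good_def)
  qed
qed

lemma chain_at_hitting_time_in:
  fixes Z :: "nat \<Rightarrow> 'w \<Rightarrow> ennreal"
  shows "chain_at Y Z (hitting_time B Y Z \<omega>) \<omega> \<in> Some ` C \<longleftrightarrow>
    (\<exists>n. Y n \<omega> \<in> B \<inter> C \<and> (\<Sum>k<n. Z k \<omega>) < (\<Sum>k<Suc n. Z k \<omega>) \<and>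
      (\<forall>m<n. \<not> (Y m \<omega> \<in> B \<and> (\<Sum>k<m. Z k \<omega>) < (\<Sum>k<Suc m. Z k \<omega>))))"
proof -
  have "chain_at Y Z (hitting_time B Y Z \<omega>) \<omega> \<in> Some ` C \<longleftrightarrow>
      (\<exists>v\<in>C. chain_at Y Z (hitting_time B Y Z \<omega>) \<omega> = Some v)"
    by auto
  then show ?thesis unfolding chain_at_hitting_time by blast
qed

text \<open>\<open>G n\<close> will be the event \<open>0 < Z n\<close>. Putting it into the
  cylinder law makes one assumption yield both the law of \<open>Y\<close> and, because the weights
  over the finite set \<open>N y\<close> sum to 1, that every \<open>G n\<close> holds almost
  surely.\<close>

locale finite_range_chain = prob_space M for M :: "'w measure" +
  fixes A :: "'s set" and p :: "'s \<Rightarrow> 's \<Rightarrow> real" and N :: "'s \<Rightarrow> 's set"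
    and Y :: "nat \<Rightarrow> 'w \<Rightarrow> 's" and G :: "nat \<Rightarrow> 'w \<Rightarrow> bool" and x :: 's
  assumes Y_measurable [measurable]: "Y n \<in> measurable M (count_space A)"
    and G_measurable [measurable]: "Measurable.pred M (G n)"
    and start: "x \<in> A"
    and finite_N: "y \<in> A \<Longrightarrow> finite (N y)"
    and N_subset: "y \<in> A \<Longrightarrow> N y \<subseteq> A"
    and stochastic: "y \<in> A \<Longrightarrow> (\<Sum>z\<in>N y. p y z) = 1"
    and law: "(\<And>k. k \<le> n \<Longrightarrow> ys k \<in> A) \<Longrightarrow>
      prob {\<omega> \<in> space M. \<forall>k\<le>n. Y k \<omega> = ys k \<and> G k \<omega>} =
        (if ys 0 = x then 1 else 0) * (\<Prod>k<n. p (ys k) (ys (Suc k)))"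
begin

definition cyl :: "nat \<Rightarrow> (nat \<Rightarrow> 's) \<Rightarrow> 'w \<Rightarrow> bool" where
  "cyl n y \<omega> \<longleftrightarrow> (\<forall>k\<le>n. Y k \<omega> = y k \<and> G k \<omega>)"

lemma Y_eq_measurable [measurable]: "Measurable.pred M (\<lambda>\<omega>. Y n \<omega> = z)"
  by (rule measurable_compose[OF Y_measurable]) simp

lemma Y_in_measurable [measurable]: "Measurable.pred M (\<lambda>\<omega>. Y n \<omega> \<in> B)"
  by (rule measurable_compose[OF Y_measurable]) simp

lemma cyl_measurable [measurable]: "Measurable.pred M (cyl n y)"
  unfolding cyl_def by measurable

text \<open>The extensions of the cylinder by the states of \<open>N (y m)\<close> are disjoint and
  their probabilities add up to that of the cylinder, so what they leave out is null.\<close>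

lemma cyl_next:
  assumes y: "\<And>k. k \<le> m \<Longrightarrow> y k \<in> A"
  shows "AE \<omega> in M. cyl m y \<omega> \<longrightarrow> Y (Suc m) \<omega> \<in> N (y m) \<and> G (Suc m) \<omega>"
proof -
  let ?y = "\<lambda>z. y(Suc m := z)"
  let ?E = "\<lambda>z. {\<omega> \<in> space M. cyl (Suc m) (?y z) \<omega>}"
  let ?c = "(if y 0 = x then 1 else 0) * (\<Prod>k<m. p (y k) (y (Suc k)))"
  have ym: "y m \<in> A" using y by simp
  have E: "prob (?E z) = ?c * p (y m) z" if "z \<in> N (y m)" for z
  proof -
    have "prob (?E z) = (if ?y z 0 = x then 1 else 0) * (\<Prod>k<Suc m. p (?y z k) (?y z (Suc k)))"
      unfolding cyl_def by (rule law) (use that N_subset[OF ym] y le_Suc_eq in auto)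
    also have "(\<Prod>k<Suc m. p (?y z k) (?y z (Suc k))) = (\<Prod>k<m. p (y k) (y (Suc k))) * p (y m) z"
      by simp
    finally show ?thesis by (simp del: fun_upd_apply add: fun_upd_def[of y "Suc m"])
  qed
  have "prob (\<Union>z\<in>N (y m). ?E z) = (\<Sum>z\<in>N (y m). prob (?E z))"
  proof (rule finite_measure_finite_Union)
    show "finite (N (y m))" using finite_N[OF ym] .
    show "disjoint_family_on ?E (N (y m))"
      by (auto simp: disjoint_family_on_def cyl_def)
  qed auto
  also have "\<dots> = ?c * (\<Sum>z\<in>N (y m). p (y m) z)"
    using E by (simp add: sum_distrib_left)
  also have "\<dots> = prob {\<omega> \<in> space M. cyl m y \<omega>}"
    unfolding cyl_def stochastic[OF ym] by (subst law) (use y in auto)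
  finally have eq: "prob (\<Union>z\<in>N (y m). ?E z) = prob {\<omega> \<in> space M. cyl m y \<omega>}" .
  have sub: "(\<Union>z\<in>N (y m). ?E z) \<subseteq> {\<omega> \<in> space M. cyl m y \<omega>}"
    by (auto simp: cyl_def)
  have meas: "(\<Union>z\<in>N (y m). ?E z) \<in> sets M" using finite_N[OF ym] by auto
  have "prob ({\<omega> \<in> space M. cyl m y \<omega>} - (\<Union>z\<in>N (y m). ?E z)) = 0"
    by (subst finite_measure_Diff) (use meas sub eq in auto)
  then have "AE \<omega> in M. \<omega> \<notin> {\<omega> \<in> space M. cyl m y \<omega>} - (\<Union>z\<in>N (y m). ?E z)"
    using meas by (intro AE_not_in) (auto simp: null_sets_def emeasure_eq_measure)
  with AE_space show ?thesis by eventually_elim (auto simp: cyl_def)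
qed

text \<open>The probability, for the start \<open>y\<close>, that the \<open>k\<close>-th state lies
  in \<open>S k\<close> for all \<open>k \<le> l\<close>. Conditioning on the first step shifts the
  sequence \<open>S\<close>.\<close>

primrec path_weight :: "nat \<Rightarrow> (nat \<Rightarrow> 's set) \<Rightarrow> 's \<Rightarrow> real" where
  "path_weight 0 S y = indicator (S 0) y"
| "path_weight (Suc l) S y =
    indicator (S 0) y * (\<Sum>z\<in>N y. p y z * path_weight l (\<lambda>k. S (Suc k)) z)"

text \<open>The Markov property at time \<open>m\<close>: the continuation sees only the last state
  \<open>y m\<close>. The prefix must be arbitrary because each induction step appends one state to
  it.\<close>

lemma prob_cyl_path:
  assumes y: "\<And>k. k \<le> m \<Longrightarrow> y k \<in> A"
  shows "prob {\<omega> \<in> space M. cyl m y \<omega> \<and> (\<forall>k\<le>l. Y (m + k) \<omega> \<in> S k \<and> G (m + k) \<omega>)} =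
    (if y 0 = x then 1 else 0) * (\<Prod>k<m. p (y k) (y (Suc k))) * path_weight l S (y m)"
  using y
proof (induction l arbitrary: m y S)
  case 0
  have "prob {\<omega> \<in> space M. cyl m y \<omega> \<and> (\<forall>k\<le>0. Y (m + k) \<omega> \<in> S k \<and> G (m + k) \<omega>)} =
    prob (if y m \<in> S 0 then {\<omega> \<in> space M. cyl m y \<omega>} else {})"
    by (rule arg_cong[where f=prob]) (auto simp: cyl_def)
  also have "\<dots> = indicator (S 0) (y m) * prob {\<omega> \<in> space M. cyl m y \<omega>}" by simp
  finally show ?case unfolding cyl_def by (subst (asm) law) (use 0 in auto)
next
  case (Suc l)
  let ?y = "\<lambda>z. y(Suc m := z)"
  let ?c = "(if y 0 = x then 1 else 0) * (\<Prod>k<m. p (y k) (y (Suc k)))"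
  have ym: "y m \<in> A" using Suc.prems by simp
  define E where "E = {\<omega> \<in> space M. cyl m y \<omega> \<and> (\<forall>k\<le>Suc l. Y (m + k) \<omega> \<in> S k \<and> G (m + k) \<omega>)}"
  define F where "F z = {\<omega> \<in> space M. cyl (Suc m) (?y z) \<omega> \<and>
    (\<forall>k\<le>l. Y (Suc m + k) \<omega> \<in> S (Suc k) \<and> G (Suc m + k) \<omega>)}" for z
  have F_meas: "F z \<in> sets M" for z unfolding F_def by measurable
  have E_meas: "E \<in> sets M" unfolding E_def by measurable
  show ?case
  proof (cases "y m \<in> S 0")
    case False
    then have "E = {}" by (auto simp: E_def cyl_def dest: spec[of _ 0])
    then have "prob E = 0" by simp
    then show ?thesis using False unfolding E_def by simp
  next
    case True
    have F: "prob (F z) = ?c * (p (y m) z * path_weight l (\<lambda>k. S (Suc k)) z)"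
      if z: "z \<in> N (y m)" for z
    proof -
      have "prob (F z) = (if ?y z 0 = x then 1 else 0) *
        (\<Prod>k<Suc m. p (?y z k) (?y z (Suc k))) * path_weight l (\<lambda>k. S (Suc k)) (?y z (Suc m))"
        unfolding F_def by (rule Suc.IH) (use z N_subset[OF ym] Suc.prems le_Suc_eq in auto)
      also have "(\<Prod>k<Suc m. p (?y z k) (?y z (Suc k))) = (\<Prod>k<m. p (y k) (y (Suc k))) * p (y m) z"
        by simp
      finally show ?thesis by simp
    qed
    have split: "(\<forall>k\<le>Suc l. Y (m + k) \<omega> \<in> S k \<and> G (m + k) \<omega>) \<longleftrightarrow> (Y m \<omega> \<in> S 0 \<and> G m \<omega>) \<and>
      (\<forall>k\<le>l. Y (Suc m + k) \<omega> \<in> S (Suc k) \<and> G (Suc m + k) \<omega>)" for \<omega>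
      unfolding All_less_Suc2[of _ "\<lambda>k. Y (m + k) \<omega> \<in> S k \<and> G (m + k) \<omega>", unfolded less_Suc_eq_le]
      by (simp add: less_Suc_eq_le)
    have step: "AE \<omega> in M. cyl m y \<omega> \<longrightarrow> Y (Suc m) \<omega> \<in> N (y m) \<and> G (Suc m) \<omega>"
      by (rule cyl_next) (use Suc.prems in auto)
    have "prob E = prob (\<Union>z\<in>N (y m). F z)"
    proof (rule finite_measure_eq_AE)
      show "AE \<omega> in M. (\<omega> \<in> E) = (\<omega> \<in> (\<Union>z\<in>N (y m). F z))"
        using step AE_space
      proof eventually_elim
        case (elim \<omega>)
        have "cyl (Suc m) (?y z) \<omega> \<longleftrightarrow> cyl m y \<omega> \<and> Y (Suc m) \<omega> = z \<and> G (Suc m) \<omega>" for z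
          by (auto simp: cyl_def le_Suc_eq)
        then show ?case using elim True
          unfolding E_def F_def split by (auto simp: cyl_def)
      qed
    qed (use E_meas F_meas finite_N[OF ym] in auto)
    also have "\<dots> = (\<Sum>z\<in>N (y m). prob (F z))"
    proof (rule finite_measure_finite_Union)
      show "finite (N (y m))" using finite_N[OF ym] .
      show "disjoint_family_on F (N (y m))"
        by (auto simp: disjoint_family_on_def F_def cyl_def)
    qed (use F_meas in auto)
    also have "\<dots> = ?c * (\<Sum>z\<in>N (y m). p (y m) z * path_weight l (\<lambda>k. S (Suc k)) z)"
      unfolding sum_distrib_left by (rule sum.cong) (use F in auto)
    finally show ?thesis unfolding E_def using True by simp
  qed
qed

lemma AE_start: "AE \<omega> in M. Y 0 \<omega> = x \<and> G 0 \<omega>"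
proof -
  have "prob {\<omega> \<in> space M. \<forall>k\<le>0. Y k \<omega> = (\<lambda>_. x) k \<and> G k \<omega>} = 1"
    by (subst law) (use start in auto)
  then show ?thesis by (intro AE_I_eq_1) (auto simp: emeasure_eq_measure)
qed

lemma prob_path_G: "prob {\<omega> \<in> space M. \<forall>k\<le>l. Y k \<omega> \<in> S k \<and> G k \<omega>} = path_weight l S x"
proof -
  have "prob {\<omega> \<in> space M. \<forall>k\<le>l. Y k \<omega> \<in> S k \<and> G k \<omega>} =
    prob {\<omega> \<in> space M. cyl 0 (\<lambda>_. x) \<omega> \<and> (\<forall>k\<le>l. Y (0 + k) \<omega> \<in> S k \<and> G (0 + k) \<omega>)}"
  proof (rule finite_measure_eq_AE)
    show "AE \<omega> in M. (\<omega> \<in> {\<omega> \<in> space M. \<forall>k\<le>l. Y k \<omega> \<in> S k \<and> G k \<omega>}) =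
      (\<omega> \<in> {\<omega> \<in> space M. cyl 0 (\<lambda>_. x) \<omega> \<and> (\<forall>k\<le>l. Y (0 + k) \<omega> \<in> S k \<and> G (0 + k) \<omega>)})"
      using AE_start by eventually_elim (auto simp: cyl_def)
  qed measurable
  also have "\<dots> = path_weight l S x" by (subst prob_cyl_path) (use start in auto)
  finally show ?thesis .
qed

lemma path_weight_UNIV: "y \<in> A \<Longrightarrow> path_weight l (\<lambda>_. UNIV) y = 1"
proof (induction l arbitrary: y)
  case (Suc l)
  have "(\<Sum>z\<in>N y. p y z * path_weight l (\<lambda>_. UNIV) z) = (\<Sum>z\<in>N y. p y z)"
    using Suc.IH N_subset[OF Suc.prems] by (intro sum.cong) auto
  then show ?case using stochastic[OF Suc.prems] by simp
qed simp

text \<open>Without restriction on the states the path weight is 1, so \<open>G 0\<close>, ...,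
  \<open>G n\<close> hold together with probability 1.\<close>

lemma AE_G: "AE \<omega> in M. \<forall>n. G n \<omega>"
proof (subst AE_all_countable, intro allI)
  fix n
  have "prob {\<omega> \<in> space M. \<forall>k\<le>n. Y k \<omega> \<in> UNIV \<and> G k \<omega>} = 1"
    unfolding prob_path_G using path_weight_UNIV start by simp
  then have "AE \<omega> in M. \<forall>k\<le>n. Y k \<omega> \<in> UNIV \<and> G k \<omega>"
    by (intro AE_I_eq_1) (auto simp: emeasure_eq_measure)
  then show "AE \<omega> in M. G n \<omega>" by eventually_elim auto
qed

lemma prob_path: "prob {\<omega> \<in> space M. \<forall>k\<le>l. Y k \<omega> \<in> S k} = path_weight l S x"
  unfolding prob_path_G[symmetric]
proof (rule finite_measure_eq_AE)
  show "AE \<omega> in M. (\<omega> \<in> {\<omega> \<in> space M. \<forall>k\<le>l. Y k \<omega> \<in> S k}) =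
    (\<omega> \<in> {\<omega> \<in> space M. \<forall>k\<le>l. Y k \<omega> \<in> S k \<and> G k \<omega>})"
    using AE_G by eventually_elim auto
qed measurable

end

section \<open>The tree and its matrix\<close>

locale ultrametric_tree =
  fixes I :: "'a set" and U :: "'a \<Rightarrow> 'a \<Rightarrow> real" and w :: "nat \<Rightarrow> real"
  assumes ultrametric: "ultrametric_matrix I U"
    and H1: "distinct_rows I U"
    and H2: "discrete_weights I U w"
    and H3: "finite_classes I U"
begin

lemma U_sym: "i \<in> I \<Longrightarrow> j \<in> I \<Longrightarrow> U i j = U j i"
  using ultrametric by (auto simp: ultrametric_matrix_def)

lemma U_min: "i \<in> I \<Longrightarrow> j \<in> I \<Longrightarrow> k \<in> I \<Longrightarrow> min (U i k) (U k j) \<le> U i j"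
  using ultrametric by (auto simp: ultrametric_matrix_def)

lemma U_diag: "i \<in> I \<Longrightarrow> j \<in> I \<Longrightarrow> U i j \<le> U i i"
  using U_min[of i i j] U_sym[of i j] by simp

lemma U_diag': "i \<in> I \<Longrightarrow> j \<in> I \<Longrightarrow> U i j \<le> U j j"
  using U_diag[of j i] U_sym[of i j] by simp

lemma strict_mono_w: "strict_mono w"
  using H2 by (auto simp: discrete_weights_def)

lemma w_eq_iff [simp]: "w m = w n \<longleftrightarrow> m = n"
  using strict_mono_w by (rule strict_mono_eq)

lemma w_less_iff [simp]: "w m < w n \<longleftrightarrow> m < n"
  using strict_mono_w by (rule strict_mono_less)

lemma w_le_iff [simp]: "w m \<le> w n \<longleftrightarrow> m \<le> n"
  using strict_mono_w by (rule strict_mono_less_eq)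

lemma w_Suc_le: "w (Suc n) \<le> u \<Longrightarrow> w n \<le> u"
  by (erule order_trans[rotated]) simp

lemma w_weight: "w n \<in> weights I U"
  using H2 by (auto simp: discrete_weights_def)

lemma w_pos: "0 < w n"
  using H2 w_weight[of n] by (auto simp: discrete_weights_def)

lemma U_cases:
  assumes "i \<in> I" "j \<in> I" obtains n where "U i j = w n"
proof -
  have "U i j \<in> range w" using assms H2 by (auto simp: discrete_weights_def weights_def)
  with that show thesis by auto
qed

lemma U_pos: "i \<in> I \<Longrightarrow> j \<in> I \<Longrightarrow> 0 < U i j"
  by (metis U_cases w_pos)

lemma w0_le: "i \<in> I \<Longrightarrow> j \<in> I \<Longrightarrow> w 0 \<le> U i j"
  by (metis U_cases w_le_iff le0)

section \<open>Tree vertices described by a level and a representative\<close>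

definition cls :: "real \<Rightarrow> 'a \<Rightarrow> 'a set" where
  "cls u i = {k \<in> I. u \<le> U i k}"

definition vx :: "nat \<Rightarrow> 'a \<Rightarrow> 'a vertex" where
  "vx n i = (cls (w n) i, w n)"

lemma upper_rel_Image:
  assumes "i \<in> I" "u \<le> U i i" shows "upper_rel I U u `` {i} = cls u i"
  using assms U_diag U_sym
  by (auto simp: upper_rel_def upper_def cls_def) (metis order_trans)

lemma cls_eq:
  assumes "i \<in> I" "k \<in> cls u i" shows "cls u k = cls u i"
proof -
  have k: "k \<in> I" "u \<le> U i k" using assms by (auto simp: cls_def)
  have "u \<le> U k l \<longleftrightarrow> u \<le> U i l" if "l \<in> I" for l
    using U_min[of k l i] U_min[of i l k] U_sym[of i k] that assms(1) k by linarith
  then show ?thesis unfolding cls_def by blast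
qed

lemma cls_self: "i \<in> I \<Longrightarrow> u \<le> U i i \<Longrightarrow> i \<in> cls u i"
  by (simp add: cls_def)

lemma cls_diag: "i \<in> I \<Longrightarrow> k \<in> cls u i \<Longrightarrow> k \<in> I \<and> u \<le> U k k"
  using U_diag[of k i] U_sym[of i k] by (auto simp: cls_def)

lemma tree_eq: "tree I U = {vx n i | n i. i \<in> I \<and> w n \<le> U i i}" (is "_ = ?R")
proof -
  have "upper I U (w n) // upper_rel I U (w n) = cls (w n) ` {i \<in> I. w n \<le> U i i}" for n
    using upper_rel_Image unfolding quotient_def upper_def by auto
  moreover have "weights I U = range w" using H2 by (auto simp: discrete_weights_def)
  ultimately show ?thesis by (auto simp: tree_def vx_def)
qed

lemma vx_in_tree: "i \<in> I \<Longrightarrow> w n \<le> U i i \<Longrightarrow> vx n i \<in> tree I U"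
  unfolding tree_eq by blast

lemma tree_cases:
  assumes "x \<in> tree I U" obtains n i where "i \<in> I" "w n \<le> U i i" "x = vx n i"
  using assms unfolding tree_eq by blast

lemma level_vx [simp]: "level w (vx n i) = n"
  by (simp add: level_def vx_def)

lemma fst_vx [simp]: "fst (vx n i) = cls (w n) i" and snd_vx [simp]: "snd (vx n i) = w n"
  by (auto simp: vx_def)

lemma vx_eq_iff:
  assumes "i \<in> I" "w m \<le> U i i" "j \<in> I"
  shows "vx m i = vx n j \<longleftrightarrow> m = n \<and> w m \<le> U i j"
proof
  assume "vx m i = vx n j"
  then have "m = n" "cls (w m) i = cls (w m) j" by (auto simp: vx_def)
  moreover from this have "i \<in> cls (w m) j" using assms cls_self by auto
  ultimately show "m = n \<and> w m \<le> U i j" using assms U_sym by (auto simp: cls_def)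
next
  assume "m = n \<and> w m \<le> U i j"
  moreover from this have "j \<in> cls (w m) i" using assms by (auto simp: cls_def)
  ultimately show "vx m i = vx n j" using assms cls_eq[of i j] by (auto simp: vx_def)
qed

lemma vx_member:
  assumes "x \<in> tree I U" "e \<in> fst x"
  shows "e \<in> I" "w (level w x) \<le> U e e" "x = vx (level w x) e"
proof -
  obtain n i where i: "i \<in> I" "x = vx n i" using assms(1) by (rule tree_cases)
  have e: "e \<in> cls (w n) i" using assms(2) i by simp
  show "e \<in> I" "w (level w x) \<le> U e e" using cls_diag[OF i(1) e] i(2) by simp_all
  have "vx n e = x" using cls_eq[OF i(1) e] i(2) by (simp add: vx_def)
  then show "x = vx (level w x) e" by (metis level_vx)
qed

lemma fst_nonempty: "x \<in> tree I U \<Longrightarrow> \<exists>e. e \<in> fst x"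
  by (elim tree_cases) (auto intro: cls_self)

lemma emb_vx:
  assumes "i \<in> I" obtains n where "U i i = w n" "emb I U i = vx n i"
  using assms by (metis U_cases emb_def order_refl upper_rel_Image vx_def)

lemma emb_in_tree: "i \<in> I \<Longrightarrow> emb I U i \<in> tree I U"
  by (metis emb_vx order_refl vx_in_tree)

text \<open>Equal images force \<open>U i i = U j j \<le> U i j\<close>; the ultrametric inequality
  then makes the rows of \<open>i\<close> and \<open>j\<close> coincide, against (H1).\<close>

lemma emb_inj:
  assumes i: "i \<in> I" and j: "j \<in> I" and eq: "emb I U i = emb I U j" shows "i = j"
proof (rule ccontr)
  assume "i \<noteq> j"
  then obtain k where k: "k \<in> I" "U i k \<noteq> U j k" using H1 i j by (auto simp: distinct_rows_def)
  obtain m where m: "U i i = w m" "emb I U i = vx m i" using emb_vx[OF i] .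
  obtain n where n: "U j j = w n" "emb I U j = vx n j" using emb_vx[OF j] .
  have "m = n" "w m \<le> U i j" using eq i j m n by (auto simp: vx_eq_iff)
  then have "U i k = U j k"
    using U_min[of i k j] U_min[of j k i] U_diag[of i k] U_diag[of j k] U_sym[of i j] i j k m n
    by auto
  with k show False by simp
qed

lemma emb_eq_iff: "i \<in> I \<Longrightarrow> j \<in> I \<Longrightarrow> emb I U i = emb I U j \<longleftrightarrow> i = j"
  using emb_inj by blast

section \<open>Edges, predecessors and local finiteness\<close>

lemma linked_sym: "linked I U w x y \<longleftrightarrow> linked I U w y x"
  unfolding linked_def by (auto simp: insert_commute)

lemma linked_tree: "linked I U w x y \<Longrightarrow> x \<in> tree I U \<and> y \<in> tree I U"
  by (auto simp: linked_def)

text \<open>A common element of the two classes represents both vertices, so one index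
  \<open>e\<close> describes the whole edge.\<close>

lemma successors_iff:
  "y \<in> successors I U w x \<longleftrightarrow> (\<exists>n e. e \<in> I \<and> w (Suc n) \<le> U e e \<and> x = vx n e \<and> y = vx (Suc n) e)"
proof
  assume y: "y \<in> successors I U w x"
  then obtain e where e: "e \<in> fst x" "e \<in> fst y" and l: "level w y = Suc (level w x)"
    and t: "x \<in> tree I U" "y \<in> tree I U"
    by (auto simp: successors_def linked_def)
  show "\<exists>n e. e \<in> I \<and> w (Suc n) \<le> U e e \<and> x = vx n e \<and> y = vx (Suc n) e"
    using vx_member[OF t(1) e(1)] vx_member[OF t(2) e(2)] l by metis
next
  assume "\<exists>n e. e \<in> I \<and> w (Suc n) \<le> U e e \<and> x = vx n e \<and> y = vx (Suc n) e"
  then obtain n e where e: "e \<in> I" "w (Suc n) \<le> U e e" "x = vx n e" "y = vx (Suc n) e" by blast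
  then have n: "w n \<le> U e e" using w_Suc_le by blast
  then have "e \<in> fst x \<inter> fst y" using e cls_self by auto
  then show "y \<in> successors I U w x"
    using e n vx_in_tree by (auto simp: successors_def linked_def)
qed

lemma linked_iff:
  "linked I U w x y \<longleftrightarrow> y \<in> successors I U w x \<or> x \<in> successors I U w y"
proof
  assume l: "linked I U w x y"
  then obtain n where n: "{snd x, snd y} = {w n, w (Suc n)}" and "x \<in> tree I U" "y \<in> tree I U"
    by (auto simp: linked_def)
  then obtain a i b j where "x = vx a i" "y = vx b j" by (metis tree_cases)
  then show "y \<in> successors I U w x \<or> x \<in> successors I U w y"
    using n l linked_sym[of x y] by (auto simp: successors_def doubleton_eq_iff)
qed (auto simp: successors_def linked_sym)

lemma level_successors: "y \<in> successors I U w x \<Longrightarrow> level w y = Suc (level w x)"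
  by (simp add: successors_def)

lemma linked_neq: "linked I U w x y \<Longrightarrow> x \<noteq> y"
  by (metis linked_iff level_successors n_not_Suc_n)

lemma parent_unique:
  assumes "y \<in> successors I U w x" "y \<in> successors I U w x'" shows "x = x'"
proof -
  obtain n e where 1: "e \<in> I" "w (Suc n) \<le> U e e" "x = vx n e" "y = vx (Suc n) e"
    using assms(1) unfolding successors_iff by blast
  obtain m d where 2: "d \<in> I" "w (Suc m) \<le> U d d" "x' = vx m d" "y = vx (Suc m) d"
    using assms(2) unfolding successors_iff by blast
  have "m = n" "w (Suc n) \<le> U e d" using 1 2 U_sym[of e d] by (auto simp: vx_eq_iff)
  then show ?thesis using 1 2 w_Suc_le by (simp add: vx_eq_iff)
qed

lemma finite_successors: "finite (successors I U w x)"
proof (rule finite_subset)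
  let ?u = "w (Suc (level w x))"
  show "successors I U w x \<subseteq> (upper I U ?u // upper_rel I U ?u) \<times> {?u}"
  proof
    fix y assume y: "y \<in> successors I U w x"
    then have t: "y \<in> tree I U" using linked_tree[of x y] by (simp add: successors_def)
    then obtain e where "e \<in> fst y" using fst_nonempty by blast
    then have "snd y = ?u" using vx_member[OF t] level_successors[OF y] by (metis snd_vx)
    then show "y \<in> (upper I U ?u // upper_rel I U ?u) \<times> {?u}"
      using t by (cases y) (simp add: tree_def)
  qed
  show "finite ((upper I U ?u // upper_rel I U ?u) \<times> {?u})"
    using H3 w_weight by (auto simp: finite_classes_def)
qed

lemma root_eq:
  assumes "i \<in> I" shows "root I U w = vx 0 i"
  unfolding root_def
proof (rule the_equality)
  show "vx 0 i \<in> tree I U \<and> snd (vx 0 i) = w 0"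
    using assms w0_le by (auto intro: vx_in_tree)
  fix x assume "x \<in> tree I U \<and> snd x = w 0"
  then show "x = vx 0 i"
    using assms w0_le by (auto elim!: tree_cases simp: vx_eq_iff)
qed

lemma root_iff: "x \<in> tree I U \<Longrightarrow> x = root I U w \<longleftrightarrow> level w x = 0"
  by (elim tree_cases) (auto simp: root_eq vx_eq_iff w0_le)

lemma parent_exists:
  assumes "x \<in> tree I U" "x \<noteq> root I U w" shows "\<exists>y. x \<in> successors I U w y"
  using assms unfolding root_iff[OF assms(1)] successors_iff
  by (elim tree_cases) (metis level_vx not0_implies_Suc)

lemma root_no_parent: "root I U w \<notin> successors I U w y"
proof
  assume *: "root I U w \<in> successors I U w y"
  then obtain n e where "e \<in> I" "root I U w = vx (Suc n) e" unfolding successors_iff by blast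
  then show False by (metis level_vx root_eq nat.distinct(1))
qed

definition nbrs :: "'a vertex \<Rightarrow> 'a vertex set" where
  "nbrs x = {y. linked I U w x y}"

lemma finite_nbrs: "finite (nbrs x)"
proof -
  have "finite {y. x \<in> successors I U w y}"
  proof (cases "\<exists>p. x \<in> successors I U w p")
    case True
    then obtain p where "x \<in> successors I U w p" by blast
    then have "{y. x \<in> successors I U w y} \<subseteq> {p}" using parent_unique by blast
    then show ?thesis by (rule finite_subset) simp
  next
    case False
    then have "{y. x \<in> successors I U w y} = {}" by blast
    then show ?thesis by (simp only: finite.emptyI)
  qed
  moreover have "nbrs x = successors I U w x \<union> {y. x \<in> successors I U w y}"
    by (auto simp: nbrs_def linked_iff)
  ultimately show ?thesis using finite_successors by simp
qed

lemma nbrs_tree: "y \<in> nbrs x \<Longrightarrow> x \<in> tree I U \<and> y \<in> tree I U"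
  using linked_tree by (auto simp: nbrs_def)

lemma not_self_nbr: "x \<notin> nbrs x"
  using linked_neq unfolding nbrs_def by blast

section \<open>Conductances and holding rates\<close>

definition cond :: "'a vertex \<Rightarrow> 'a vertex \<Rightarrow> real" where
  "cond x y = (if linked I U w x y then 1 / weight_gap w (max (level w x) (level w y)) else 0)"

definition rate :: "'a vertex \<Rightarrow> real" where
  "rate x = - tree_Q I U w x x"

lemma weight_gap_pos: "0 < weight_gap w n"
  using w_pos strict_mono_w by (auto simp: weight_gap_def strict_mono_def)

lemma cond_sym: "cond x y = cond y x"
  using linked_sym by (auto simp: cond_def max.commute)

lemma cond_pos: "y \<in> nbrs x \<Longrightarrow> 0 < cond x y"
  using weight_gap_pos by (auto simp: cond_def nbrs_def)

lemma cond_nonneg: "0 \<le> cond x y"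
  using weight_gap_pos[THEN less_imp_le] by (simp add: cond_def)

lemma cond_eq_0: "y \<notin> nbrs x \<Longrightarrow> cond x y = 0"
  by (auto simp: cond_def nbrs_def)

lemma tree_Q_cond:
  assumes "x \<noteq> y" shows "tree_Q I U w x y = cond x y"
proof (cases "x \<in> successors I U w y")
  case True
  then show ?thesis using assms level_successors[OF True]
    by (simp add: tree_Q_def cond_def linked_iff)
next
  case no: False
  show ?thesis
  proof (cases "y \<in> successors I U w x")
    case True
    then show ?thesis using assms no level_successors[OF True]
      by (simp add: tree_Q_def cond_def linked_iff)
  qed (use assms no in \<open>simp add: tree_Q_def cond_def linked_iff\<close>)
qed

lemma rate_pos: "0 < rate x"
proof -
  have "0 < 1 / weight_gap w n" for n using weight_gap_pos by simp
  then show ?thesis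
    unfolding rate_def tree_Q_def by (simp add: add_nonneg_pos less_imp_le)
qed

lemma sum_nbrs_root:
  fixes g :: "'a vertex \<Rightarrow> 'b :: comm_monoid_add"
  shows "(\<Sum>y\<in>nbrs (root I U w). g y) = (\<Sum>y\<in>successors I U w (root I U w). g y)"
  using root_no_parent by (intro sum.cong) (auto simp: nbrs_def linked_iff)

lemma sum_nbrs_parent:
  fixes g :: "'a vertex \<Rightarrow> 'b :: comm_monoid_add"
  assumes "x \<in> successors I U w p"
  shows "(\<Sum>y\<in>nbrs x. g y) = g p + (\<Sum>y\<in>successors I U w x. g y)"
proof -
  have "nbrs x = insert p (successors I U w x)"
    unfolding nbrs_def linked_iff using assms parent_unique by blast
  moreover have "p \<notin> successors I U w x"
    using level_successors[OF assms] level_successors[of p x] by auto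
  ultimately show ?thesis by (simp add: finite_successors)
qed

lemma cond_successor:
  "y \<in> successors I U w x \<Longrightarrow> cond x y = 1 / weight_gap w (Suc (level w x))"
  using level_successors[of y x] by (auto simp: cond_def linked_iff)

text \<open>Since \<open>weight_gap w 0 = w 0\<close>, the term of \<open>rate\<close> that belongs
  to the predecessor is, at the root, the absorption rate. This is what makes the jump probabilities
  sum to 1.\<close>

lemma rate_eq:
  assumes "x \<in> tree I U"
  shows "rate x = (\<Sum>y\<in>nbrs x. cond x y) + (if x = root I U w then 1 / w 0 else 0)"
proof (cases "x = root I U w")
  case True
  then have "level w x = 0" using root_iff assms by simp
  then show ?thesis unfolding True[symmetric] using True
    by (simp add: rate_def tree_Q_def sum_nbrs_root cond_successor weight_gap_def)
next
  case False
  then obtain p where p: "x \<in> successors I U w p" using parent_exists assms by blast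
  then have "cond x p = 1 / weight_gap w (level w x)"
    using cond_sym[of x p] cond_successor[OF p] level_successors[OF p] by simp
  then show ?thesis using False
    by (simp add: rate_def tree_Q_def sum_nbrs_parent[OF p] cond_successor)
qed

text \<open>For \<open>x = (E, u)\<close> this is the entry \<open>w\<^bsub>|x \<and> j|\<^esub>\<close> of the tree matrix; by the ultrametric
  inequality it does not depend on the representative of \<open>E\<close>.\<close>

definition potential :: "'a \<Rightarrow> 'a vertex \<Rightarrow> real" where
  "potential j x = min (snd x) (U (SOME e. e \<in> fst x) j)"

text \<open>Two members \<open>d\<close>, \<open>e\<close> of the class have
  \<open>w n \<le> U e d\<close>, so \<open>U d j\<close> and \<open>U e j\<close> can differ only
  where both are at least \<open>w n\<close>, and there the minimum hides the difference.\<close>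

lemma potential_vx:
  assumes "e \<in> I" "w n \<le> U e e" "j \<in> I"
  shows "potential j (vx n e) = min (w n) (U e j)"
proof -
  define d where "d = (SOME e'. e' \<in> fst (vx n e))"
  have "d \<in> fst (vx n e)" unfolding d_def
    by (rule someI[of _ e]) (use assms cls_self in auto)
  then have d: "d \<in> I" "w n \<le> U e d" by (auto simp: cls_def)
  have "min (w n) (U d j) = min (w n) (U e j)"
    using U_min[of e j d] U_min[of d j e] U_sym[of e d] d assms by auto
  then show ?thesis by (simp add: potential_def d_def)
qed

lemma potential_emb:
  assumes "k \<in> I" "j \<in> I" shows "potential j (emb I U k) = U k j"
  using emb_vx[OF assms(1)] U_diag[OF assms] assms by (metis min.absorb2 order_refl potential_vx)

lemma potential_bounds:
  assumes "x \<in> tree I U" "j \<in> I" shows "0 < potential j x" "potential j x \<le> U j j"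
proof -
  obtain n e where e: "e \<in> I" "w n \<le> U e e" "x = vx n e" using assms(1) by (rule tree_cases)
  show "0 < potential j x" using e assms w_pos U_pos by (simp add: potential_vx)
  show "potential j x \<le> U j j"
    using e assms U_diag[of j e] U_sym[of e j] by (auto simp: potential_vx)
qed

text \<open>Let \<open>n\<close> be the level of \<open>x\<close>, \<open>b\<close> that of the
  image of \<open>j\<close>, and \<open>U e j = w c\<close>. Then \<open>x\<close> is on the way
  from the root to \<open>j\<close> iff \<open>n \<le> c\<close>. In that case the edge to the
  predecessor (at the root, absorption) contributes \<open>- 1\<close>, and the edge towards
  \<open>j\<close> contributes \<open>1\<close> unless \<open>n = b\<close>. Otherwise the potential
  does not change between \<open>x\<close> and its neighbours.\<close>

lemma potential_laplacian:
  assumes x: "x \<in> tree I U" and j: "j \<in> I"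
  shows "(\<Sum>y\<in>nbrs x. cond x y * potential j y) - rate x * potential j x =
    (if x = emb I U j then - 1 else 0)"
proof -
  obtain n e where e: "e \<in> I" "w n \<le> U e e" "x = vx n e" using x by (rule tree_cases)
  obtain c where c: "U e j = w c" using U_cases e(1) j by blast
  obtain b where b: "U j j = w b" "emb I U j = vx b j" using emb_vx[OF j] .
  have cb: "c \<le> b" using U_diag'[of e j] e j b c by simp
  have x_j: "x = emb I U j \<longleftrightarrow> n \<le> c \<and> b = n"
    unfolding e(3) b(2) using vx_eq_iff[OF e(1,2) j] c by auto
  have lev: "level w x = n" by (simp add: e)
  have f: "potential j x = min (w n) (w c)" using e c j by (simp add: potential_vx)
  have succ: "(\<Sum>y\<in>successors I U w x. cond x y * (potential j y - potential j x)) =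
    (if n \<le> c \<and> n < b then 1 else 0)"
  proof -
    \<comment> \<open>Only the successor towards \<open>j\<close> has a larger potential; its
      increment \<open>weight_gap w (Suc n)\<close> cancels the conductance.\<close>
    have contrib: "cond x y * (potential j y - potential j x) =
        (if y = vx (Suc n) j then if n < b then 1 else 0 else 0)"
      if y: "y \<in> successors I U w x" for y
    proof -
      obtain d where d: "d \<in> I" "w (Suc n) \<le> U d d" "x = vx n d" "y = vx (Suc n) d"
        using y e(3) unfolding successors_iff by (metis level_vx)
      obtain a where a: "U d j = w a" using U_cases d(1) j by blast
      have wn: "w n \<le> U d d" using d(2) by (rule w_Suc_le)
      have fx: "potential j x = min (w n) (w a)" using d wn a j by (simp add: potential_vx)
      have fy: "potential j y = min (w (Suc n)) (w a)" using d wn a j by (simp add: potential_vx)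
      have eq: "y = vx (Suc n) j \<longleftrightarrow> Suc n \<le> a" using d a j by (simp add: vx_eq_iff)
      have ab: "a \<le> b" using U_diag'[of d j] d j a b by simp
      have diff: "potential j y - potential j x =
          (if Suc n \<le> a then weight_gap w (Suc n) else 0)"
        unfolding fx fy by (auto simp: min_def weight_gap_def)
      show ?thesis unfolding cond_successor[OF y] lev diff eq
        using ab weight_gap_pos[of "Suc n"] by auto
    qed
    have "vx (Suc n) j \<in> successors I U w x \<longleftrightarrow> n \<le> c" if "n < b"
    proof
      assume "vx (Suc n) j \<in> successors I U w x"
      then obtain d where d: "d \<in> I" "w (Suc n) \<le> U d d" "x = vx n d" "vx (Suc n) j = vx (Suc n) d"
        unfolding successors_iff using e(3) by (metis level_vx)
      have "w (Suc n) \<le> U d j" using d j vx_eq_iff[of d "Suc n" j "Suc n"] by simp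
      then have "w n \<le> U d j" by (rule w_Suc_le)
      moreover have "w n \<le> U e d" using d(1,3) e vx_eq_iff[of e n d n] by simp
      ultimately have "w n \<le> U e j" using U_min[of e j d] e d j by auto
      then show "n \<le> c" by (simp add: c)
    next
      assume "n \<le> c"
      then have "x = vx n j" using e c j by (simp add: vx_eq_iff)
      then show "vx (Suc n) j \<in> successors I U w x"
        unfolding successors_iff using j b that by (intro exI[of _ n] exI[of _ j]) simp
    qed
    moreover have "(\<Sum>y\<in>successors I U w x. cond x y * (potential j y - potential j x)) =
      (\<Sum>y\<in>successors I U w x. if y = vx (Suc n) j then if n < b then 1 else 0 else 0)"
      by (rule sum.cong[OF refl contrib])
    ultimately show ?thesis by (simp add: finite_successors)
  qed
  \<comment> \<open>Passing to differences absorbs \<open>rate x\<close> up to the absorption term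
    at the root.\<close>
  have grad: "(\<Sum>y\<in>nbrs x. cond x y * potential j y) - rate x * potential j x =
    (\<Sum>y\<in>nbrs x. cond x y * (potential j y - potential j x))
      - (if x = root I U w then potential j x / w 0 else 0)"
    unfolding rate_eq[OF x]
    by (cases "x = root I U w") (simp_all add: ring_distribs sum_subtractf sum_distrib_right)
  show ?thesis
  proof (cases "x = root I U w")
    case True
    then have n: "n = 0" using root_iff[OF x] lev by simp
    have "potential j x / w 0 = 1" using f w_pos[of 0] by (simp add: n min_def)
    moreover have "(\<Sum>y\<in>nbrs x. cond x y * (potential j y - potential j x)) =
      (\<Sum>y\<in>successors I U w x. cond x y * (potential j y - potential j x))"
      unfolding True by (rule sum_nbrs_root)
    ultimately show ?thesis unfolding grad succ x_j using True n by auto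
  next
    case False
    then obtain p where p: "x \<in> successors I U w p" using parent_exists x by blast
    then obtain m d where d: "d \<in> I" "w (Suc m) \<le> U d d" "p = vx m d" "x = vx (Suc m) d"
      unfolding successors_iff by blast
    have n: "n = Suc m" and "w n \<le> U e d" using d e vx_eq_iff[of e n d "Suc m"] by auto
    then have "p = vx m e" using d e vx_eq_iff[of e m d m] by (smt (verit) lessI w_less_iff)
    moreover have "w m \<le> U e e" using e(2) n w_Suc_le by blast
    ultimately have fp: "potential j p = min (w m) (w c)" using e c j by (simp add: potential_vx)
    have cp: "cond x p = 1 / weight_gap w n"
      using cond_sym[of x p] cond_successor[OF p] level_successors[OF p] lev by simp
    have "cond x p * (potential j p - potential j x) = (if n \<le> c then - 1 else 0)"
    proof (cases "n \<le> c")
      case True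
      then have "potential j p - potential j x = - weight_gap w n"
        unfolding f fp by (simp add: n min_def weight_gap_def)
      then show ?thesis using True weight_gap_pos[of n] by (simp add: cp)
    next
      case False
      then have "potential j p - potential j x = 0"
        unfolding f fp by (simp add: n min_def)
      then show ?thesis using False by simp
    qed
    then have "(\<Sum>y\<in>nbrs x. cond x y * (potential j y - potential j x)) =
      (if n \<le> c then - 1 else 0) + (if n \<le> c \<and> n < b then 1 else 0)"
      unfolding sum_nbrs_parent[OF p] succ by simp
    then show ?thesis unfolding grad x_j using False cb by auto
  qed
qed

section \<open>Geodesics\<close>

abbreviation walk :: "'a vertex list \<Rightarrow> bool" where
  "walk p \<equiv> successively (linked I U w) p"

text \<open>The subtree hanging from \<open>a\<close>. Inclusion of classes alone would not describe
  it: consecutive levels may carry the same set of indices, and then the predecessor of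
  \<open>a\<close> would be included.\<close>

definition branch :: "'a vertex \<Rightarrow> 'a vertex set" where
  "branch a = {y \<in> tree I U. level w a \<le> level w y \<and> fst y \<subseteq> fst a}"

lemma successor_fst_subset: "y \<in> successors I U w x \<Longrightarrow> fst y \<subseteq> fst x"
  unfolding successors_iff by (auto simp: cls_def intro: w_Suc_le)

text \<open>Going up from \<open>y\<close>, the class stays inside \<open>fst a\<close> until the
  level drops below that of \<open>a\<close>, so the edge from \<open>a\<close> to its predecessor
  is the only exit. This is how acyclicity enters.\<close>

lemma branch_exit:
  assumes a: "a \<in> successors I U w x" and l: "linked I U w y z"
    and y: "y \<in> branch a" and z: "z \<notin> branch a"
  shows "y = a \<and> z = x"
proof -
  have t: "y \<in> tree I U" "z \<in> tree I U" "a \<in> tree I U"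
    using linked_tree[OF l] linked_tree[of x a] a by (auto simp: linked_iff)
  have ya: "level w a \<le> level w y" "fst y \<subseteq> fst a" using y by (auto simp: branch_def)
  have "z \<notin> successors I U w y"
    using z t ya successor_fst_subset[of z y] level_successors[of z y]
    unfolding branch_def by auto
  then have yz: "y \<in> successors I U w z" using l linked_iff by blast
  then obtain m d where d: "d \<in> I" "w (Suc m) \<le> U d d" "z = vx m d" "y = vx (Suc m) d"
    unfolding successors_iff by blast
  have "d \<in> fst y" using d cls_self by simp
  then have "d \<in> fst a" using ya by blast
  then have a_d: "a = vx (level w a) d" using vx_member t(3) by blast
  have "\<not> level w a \<le> m"
  proof
    assume le: "level w a \<le> m"
    then have "w (level w a) \<le> w m" by simp
    then have "cls (w m) d \<subseteq> cls (w (level w a)) d" by (auto simp: cls_def simp del: w_le_iff)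
    then have "fst z \<subseteq> fst a" unfolding d(3) by (subst a_d) simp
    with z t le show False unfolding branch_def by (simp add: d(3))
  qed
  with ya(1) have "level w a = Suc m" by (simp add: d(4))
  with a_d have "y = a" using d(4) by simp
  with yz show ?thesis using parent_unique[OF a] by blast
qed

lemma branch_self: "a \<in> tree I U \<Longrightarrow> a \<in> branch a"
  by (simp add: branch_def)

lemma walk_branch:
  assumes a: "a \<in> successors I U w x" and "walk p" "p \<noteq> []" "x \<notin> set p"
  shows "hd p \<in> branch a \<longleftrightarrow> last p \<in> branch a"
  using assms(2-)
proof (induction p)
  case (Cons y p)
  show ?case
  proof (cases "p = []")
    case False
    then have l: "linked I U w y (hd p)" and "walk p" using Cons.prems by (auto simp: successively_Cons)
    with Cons False have "hd p \<in> branch a \<longleftrightarrow> last p \<in> branch a" by simp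
    moreover have "hd p \<noteq> x" "y \<noteq> x" using Cons.prems False by auto
    then have "y \<in> branch a \<longleftrightarrow> hd p \<in> branch a"
      using branch_exit[OF a l] branch_exit[OF a linked_sym[THEN iffD1, OF l]] by blast
    ultimately show ?thesis using False by simp
  qed simp
qed simp

lemma simple_path_Cons:
  assumes "p \<noteq> []"
  shows "simple_path I U w x y (x # p) \<longleftrightarrow>
    x \<notin> set p \<and> linked I U w x (hd p) \<and> simple_path I U w (hd p) y p"
  using assms linked_tree[of x "hd p"] by (auto simp: simple_path_def successively_Cons)

lemma simple_path_hd: "simple_path I U w x y p \<Longrightarrow> \<exists>p'. p = x # p'"
  by (cases p) (auto simp: simple_path_def)

text \<open>After the step to \<open>a\<close> the path cannot leave \<open>branch a\<close> without
  meeting \<open>x\<close>, so \<open>y\<close> lies there. Read backwards, the same argument puts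
  \<open>b\<close> there, and \<open>a\<close> is the only neighbour of \<open>x\<close> in that
  branch.\<close>

lemma simple_path_first_step_child:
  assumes a: "a \<in> successors I U w x"
    and p: "simple_path I U w a y p" "x \<notin> set p"
    and q: "simple_path I U w b y q" "x \<notin> set q" and l: "linked I U w x b"
  shows "b = a"
proof -
  have "a \<in> tree I U" "x \<notin> branch a"
    using level_successors[OF a] a linked_tree[of x a] by (auto simp: branch_def linked_iff)
  then have "y \<in> branch a"
    using walk_branch[OF a, of p] p branch_self by (auto simp: simple_path_def)
  then have "b \<in> branch a" using walk_branch[OF a, of q] q by (auto simp: simple_path_def)
  then show ?thesis
    using branch_exit[OF a linked_sym[THEN iffD1, OF l]] \<open>x \<notin> branch a\<close> by blast
qed

lemma simple_path_unique:
  assumes "simple_path I U w x y p" "simple_path I U w x y q" shows "p = q"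
  using assms
proof (induction p arbitrary: x q)
  case Nil then show ?case by (simp add: simple_path_def)
next
  case (Cons x' p)
  have x': "x' = x" using Cons.prems by (simp add: simple_path_def)
  obtain q' where q: "q = x # q'" using simple_path_hd Cons.prems(2) by blast
  show ?case
  proof (cases "x = y")
    case True
    have "p = []" using Cons.prems(1) True x' by (cases p rule: rev_cases) (auto simp: simple_path_def)
    moreover have "q' = []"
      using Cons.prems(2) True q by (cases q' rule: rev_cases) (auto simp: simple_path_def)
    ultimately show ?thesis using q x' by simp
  next
    case False
    have ne: "p \<noteq> []" "q' \<noteq> []" using Cons.prems q False x' by (auto simp: simple_path_def)
    have p: "x \<notin> set p" "linked I U w x (hd p)" "simple_path I U w (hd p) y p"
      using Cons.prems(1) simple_path_Cons[OF ne(1)] x' by auto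
    have q': "x \<notin> set q'" "linked I U w x (hd q')" "simple_path I U w (hd q') y q'"
      using Cons.prems(2) simple_path_Cons[OF ne(2)] q by auto
    \<comment> \<open>If neither first step goes to a successor, both go to the unique
      predecessor.\<close>
    have "hd p = hd q'"
    proof (cases "hd p \<in> successors I U w x")
      case True
      from simple_path_first_step_child[OF True p(3,1) q'(3,1,2)] show ?thesis by simp
    next
      case nc: False
      show ?thesis
      proof (cases "hd q' \<in> successors I U w x")
        case True
        from simple_path_first_step_child[OF True q'(3,1) p(3,1,2)] show ?thesis .
      next
        case False
        then show ?thesis using nc p(2) q'(2) parent_unique unfolding linked_iff by blast
      qed
    qed
    then have "p = q'" using Cons.IH p(3) q'(3) by metis
    then show ?thesis using q x' by simp
  qed
qed

text \<open>Loop erasure: if \<open>x\<close> recurs in the path found for the tail, everything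
  before that occurrence is dropped. The inclusion of vertex sets lets the geodesic inherit from a
  walk that its interior avoids \<open>I\<close>.\<close>

lemma walk_imp_simple_path:
  assumes "walk p" "p \<noteq> []" "set p \<subseteq> tree I U"
  shows "\<exists>q. simple_path I U w (hd p) (last p) q \<and> set q \<subseteq> set p"
  using assms
proof (induction p)
  case (Cons x p)
  show ?case
  proof (cases "p = []")
    case True
    then show ?thesis using Cons.prems by (intro exI[of _ "[x]"]) (auto simp: simple_path_def)
  next
    case False
    then have l: "linked I U w x (hd p)" and "walk p" using Cons.prems by (auto simp: successively_Cons)
    with Cons False obtain q where q: "simple_path I U w (hd p) (last p) q" "set q \<subseteq> set p"
      by auto
    show ?thesis
    proof (cases "x \<in> set q")
      case False
      have "simple_path I U w x (last p) (x # q)"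
        using False l q Cons.prems by (auto simp: simple_path_def successively_Cons)
      then show ?thesis using q \<open>p \<noteq> []\<close> by (intro exI[of _ "x # q"]) auto
    next
      case True
      then obtain r s where rs: "q = r @ x # s" by (meson split_list)
      have "simple_path I U w x (last p) (x # s)"
        using q unfolding rs by (auto simp: simple_path_def successively_append_iff)
      then show ?thesis using q \<open>p \<noteq> []\<close> rs by (intro exI[of _ "x # s"]) auto
    qed
  qed
qed simp

lemma walk_from_root:
  assumes "y \<in> tree I U"
  shows "\<exists>p. walk p \<and> p \<noteq> [] \<and> set p \<subseteq> tree I U \<and> hd p = root I U w \<and> last p = y"
  using assms
proof (induction "level w y" arbitrary: y)
  case 0
  then show ?case using root_iff[of y] by (intro exI[of _ "[y]"]) auto
next
  case (Suc n)
  then have "y \<noteq> root I U w" using root_iff[of y] by auto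
  then obtain x where x: "y \<in> successors I U w x" using parent_exists Suc.prems by blast
  then have l: "linked I U w x y" by (simp add: linked_iff)
  then obtain p where "walk p" "p \<noteq> []" "set p \<subseteq> tree I U" "hd p = root I U w" "last p = x"
    using Suc.hyps(1)[of x] Suc.hyps(2) level_successors[OF x] linked_tree[OF l] by auto
  then show ?case using l Suc.prems
    by (intro exI[of _ "p @ [y]"]) (auto simp: successively_append_iff)
qed

lemma simple_path_exists:
  assumes "x \<in> tree I U" "y \<in> tree I U" shows "\<exists>p. simple_path I U w x y p"
proof -
  obtain p where p: "walk p" "p \<noteq> []" "set p \<subseteq> tree I U" "hd p = root I U w" "last p = x"
    using walk_from_root[OF assms(1)] by blast
  obtain q where q: "walk q" "q \<noteq> []" "set q \<subseteq> tree I U" "hd q = root I U w" "last q = y"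
    using walk_from_root[OF assms(2)] by blast
  have "(\<lambda>x y. linked I U w y x) = linked I U w" using linked_sym by (intro ext) blast
  then have "walk (rev p)" using p(1) by (simp only: successively_rev)
  then have "walk (rev p @ tl q)"
    using p q by (cases q) (auto simp: successively_append_iff successively_Cons last_rev)
  moreover have "hd (rev p @ tl q) = x" "last (rev p @ tl q) = y"
    using p q by (cases q; auto simp: hd_append hd_rev last_rev)+
  moreover have "set (rev p @ tl q) \<subseteq> tree I U" using p q by (cases q) auto
  ultimately show ?thesis using walk_imp_simple_path[of "rev p @ tl q"] p(2) by auto
qed

lemma geod_eq: "simple_path I U w x y p \<Longrightarrow> geod I U w x y = set p"
  unfolding geod_def using simple_path_unique by (metis the_equality)

text \<open>The initial part of the path up to \<open>k\<close> and the single edge to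
  \<open>k\<close> are simple paths with the same ends, hence equal.\<close>

lemma simple_path_neighbour:
  assumes p: "simple_path I U w x y (x # q)" and k: "linked I U w x k" "k \<in> set q"
  shows "k = hd q"
proof -
  obtain r s where rs: "q = r @ k # s" using k(2) by (meson split_list)
  have "simple_path I U w x k (x # r @ [k])"
    using p unfolding rs by (auto simp: simple_path_def successively_append_iff successively_Cons hd_append)
  moreover have "simple_path I U w x k [x, k]"
    using k linked_tree[OF k(1)] linked_neq[OF k(1)] by (auto simp: simple_path_def)
  ultimately have "x # r @ [k] = [x, k]" by (rule simple_path_unique)
  then show ?thesis by (simp add: rs)
qed

section \<open>Excursions off the index set\<close>

abbreviation "V\<^sub>I \<equiv> emb I U ` I"

definition off :: "'a vertex \<Rightarrow> 'a vertex set" where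
  "off x = nbrs x - V\<^sub>I"

lemma finite_off: "finite (off x)"
  using finite_nbrs by (simp add: off_def)

lemma off_tree: "z \<in> off x \<Longrightarrow> z \<in> tree I U - V\<^sub>I"
  using nbrs_tree[of z x] by (simp add: off_def)

lemma off_nbrs: "z \<in> off x \<Longrightarrow> z \<in> nbrs x"
  by (simp add: off_def)

text \<open>\<open>path_cond n x y\<close> is the total weight of the paths of \<open>n + 1\<close> steps from \<open>x\<close> to \<open>y\<close> whose
  interior avoids \<open>I\<close>; each step contributes its rate, and each interior vertex is divided by
  its holding rate.  This normalization makes it symmetric.\<close>

primrec path_cond :: "nat \<Rightarrow> 'a vertex \<Rightarrow> 'a vertex \<Rightarrow> real" where
  "path_cond 0 x y = cond x y"
| "path_cond (Suc n) x y = (\<Sum>z\<in>off x. cond x z / rate z * path_cond n z y)"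

lemma path_cond_nonneg: "0 \<le> path_cond n x y"
  by (induction n arbitrary: x)
    (auto intro!: sum_nonneg mult_nonneg_nonneg cond_nonneg divide_nonneg_pos rate_pos)

text \<open>The definition splits off the first step, this the last one; comparing the two forms
  gives the invariance under reversal by induction.\<close>

lemma path_cond_Suc_last:
  "path_cond (Suc n) x y = (\<Sum>z\<in>off y. path_cond n x z / rate z * cond z y)"
proof (induction n arbitrary: x)
  case 0
  have "(\<Sum>z\<in>off x. cond x z / rate z * cond z y) =
    (\<Sum>z\<in>off x \<inter> off y. cond x z / rate z * cond z y)"
    using cond_eq_0[of _ y] cond_sym[of y]
    by (intro sum.mono_neutral_right finite_off) (auto simp: off_def)
  also have "\<dots> = (\<Sum>z\<in>off y. cond x z / rate z * cond z y)"
    using cond_eq_0[of _ x] by (intro sum.mono_neutral_left finite_off) (auto simp: off_def)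
  finally show ?case by simp
next
  case (Suc n)
  have "path_cond (Suc (Suc n)) x y =
    (\<Sum>z\<in>off x. cond x z / rate z * (\<Sum>v\<in>off y. path_cond n z v / rate v * cond v y))"
    unfolding path_cond.simps(2)[of "Suc n"] Suc.IH ..
  also have "\<dots> = (\<Sum>v\<in>off y. \<Sum>z\<in>off x. cond x z / rate z * (path_cond n z v / rate v * cond v y))"
    unfolding sum_distrib_left by (rule sum.swap)
  also have "\<dots> = (\<Sum>v\<in>off y. path_cond (Suc n) x v / rate v * cond v y)"
    by (simp add: sum_distrib_right sum_divide_distrib mult.assoc)
  finally show ?case .
qed

lemma path_cond_sym: "path_cond n x y = path_cond n y x"
proof (induction n arbitrary: x y)
  case 0 show ?case by (simp add: cond_sym)
next
  case (Suc n)
  show ?case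
    unfolding path_cond_Suc_last[of n x y] path_cond.simps(2)[of n y x] Suc.IH[of x]
    by (intro sum.cong refl) (simp add: cond_sym)
qed

lemma path_cond_walk:
  assumes "path_cond n x y \<noteq> 0"
  shows "\<exists>zs. set zs \<subseteq> tree I U - V\<^sub>I \<and> walk (x # zs @ [y])"
  using assms
proof (induction n arbitrary: x)
  case 0
  then have "linked I U w x y" by (auto simp: cond_def split: if_splits)
  then show ?case by (intro exI[of _ "[]"]) auto
next
  case (Suc n)
  then have "(\<Sum>z\<in>off x. cond x z / rate z * path_cond n z y) \<noteq> 0" by simp
  then obtain z where z: "z \<in> off x" "cond x z / rate z * path_cond n z y \<noteq> 0"
    by (rule sum.not_neutral_contains_not_neutral)
  then have "path_cond n z y \<noteq> 0" by simp
  then obtain zs where "set zs \<subseteq> tree I U - V\<^sub>I" "walk (z # zs @ [y])" using Suc.IH by blast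
  moreover have "linked I U w x z" using off_nbrs[OF z(1)] by (simp add: nbrs_def)
  ultimately show ?case using off_tree[OF z(1)] by (intro exI[of _ "z # zs"]) simp
qed

lemma walk_path_cond:
  assumes "walk (x # zs @ [y])" "set zs \<inter> V\<^sub>I = {}"
  shows "0 < path_cond (length zs) x y"
  using assms
proof (induction zs arbitrary: x)
  case Nil
  then show ?case using cond_pos by (auto simp: nbrs_def)
next
  case (Cons z zs)
  then have "0 < path_cond (length zs) z y" "linked I U w x z" by (auto simp: successively_Cons)
  then have "0 < cond x z / rate z * path_cond (length zs) z y" and z: "z \<in> off x"
    using cond_pos[of z x] rate_pos Cons.prems(2) by (auto simp: off_def nbrs_def)
  then have "0 < (\<Sum>z\<in>off x. cond x z / rate z * path_cond (length zs) z y)"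
    by (intro sum_pos2[OF finite_off z] mult_nonneg_nonneg path_cond_nonneg
        divide_nonneg_pos cond_nonneg rate_pos)
  then show ?case by simp
qed

lemma path_cond_simple_path:
  assumes "path_cond n x y \<noteq> 0" "x \<in> tree I U" "y \<in> tree I U"
  shows "\<exists>p. simple_path I U w x y p \<and> set p \<subseteq> {x, y} \<union> (tree I U - V\<^sub>I)"
proof -
  obtain zs where zs: "set zs \<subseteq> tree I U - V\<^sub>I" "walk (x # zs @ [y])"
    using path_cond_walk assms(1) by blast
  obtain p where "simple_path I U w x y p" "set p \<subseteq> set (x # zs @ [y])"
    using walk_imp_simple_path[OF zs(2)] zs(1) assms by auto
  then show ?thesis using zs(1) by (intro exI[of _ p]) auto
qed

text \<open>The geodesic between neighbours is itself a path of positive weight. Conversely, erasing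
  the loops of any path of nonzero weight yields the geodesic, whose interior then avoids
  \<open>I\<close>.\<close>

lemma U_neighbours_iff:
  assumes i: "i \<in> I" and j: "j \<in> I" and ne: "i \<noteq> j"
  shows "j \<in> U_neighbours I U w i \<longleftrightarrow> (\<exists>n. path_cond n (emb I U i) (emb I U j) \<noteq> 0)"
proof
  let ?x = "emb I U i" and ?y = "emb I U j"
  have t: "?x \<in> tree I U" "?y \<in> tree I U" and xy: "?x \<noteq> ?y"
    using emb_in_tree i j ne emb_inj by auto
  { assume "j \<in> U_neighbours I U w i"
    then have g: "geod I U w ?x ?y \<inter> V\<^sub>I = {?x, ?y}" by (simp add: U_neighbours_def)
    obtain p where p: "simple_path I U w ?x ?y p" using simple_path_exists t by blast
    then obtain q where "p = ?x # q" using simple_path_hd by blast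
    moreover from this obtain zs where "q = zs @ [?y]"
      using p xy by (cases q rule: rev_cases) (auto simp: simple_path_def)
    ultimately have pz: "p = ?x # zs @ [?y]" by simp
    then have notin: "?x \<notin> set zs" "?y \<notin> set zs" and "walk p" using p by (auto simp: simple_path_def)
    have "set zs \<subseteq> set p" using pz by auto
    moreover have "set p \<inter> V\<^sub>I = {?x, ?y}" using g geod_eq[OF p] by simp
    ultimately have "v \<in> {?x, ?y}" if "v \<in> set zs \<inter> V\<^sub>I" for v using that by blast
    then have "set zs \<inter> V\<^sub>I = {}" using notin by (metis empty_iff equals0I insert_iff IntD1)
    then have "0 < path_cond (length zs) ?x ?y" using \<open>walk p\<close> walk_path_cond pz by blast
    then show "\<exists>n. path_cond n ?x ?y \<noteq> 0" by (metis less_irrefl) }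
  { assume "\<exists>n. path_cond n ?x ?y \<noteq> 0"
    then obtain p where p: "simple_path I U w ?x ?y p" "set p \<subseteq> {?x, ?y} \<union> (tree I U - V\<^sub>I)"
      using path_cond_simple_path t by blast
    have "?x \<in> set p" "?y \<in> set p"
      using p(1) unfolding simple_path_def by (metis hd_in_set, metis last_in_set)
    then have "geod I U w ?x ?y \<inter> V\<^sub>I = {?x, ?y}" unfolding geod_eq[OF p(1)] using p(2) i j by auto
    then show "j \<in> U_neighbours I U w i" using j ne by (auto simp: U_neighbours_def) }
qed

text \<open>Loop erasure of the path from \<open>z\<close> leaves one that misses the image of
  \<open>i\<close>; with that image put in front it is the geodesic, and \<open>z\<close> is its
  second vertex. So all excursions from \<open>i\<close> to \<open>j\<close> start with the same
  vertex, and there are none if \<open>i\<close> and \<open>j\<close> are linked.\<close>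

lemma excursion_geod:
  assumes i: "i \<in> I" and j: "j \<in> I" and ne: "i \<noteq> j"
    and z: "z \<in> off (emb I U i)" and pc: "path_cond n z (emb I U j) \<noteq> 0"
  shows "z \<in> geod I U w (emb I U i) (emb I U j)"
    and "linked I U w (emb I U i) k \<Longrightarrow> k \<in> geod I U w (emb I U i) (emb I U j) \<Longrightarrow> k = z"
    and "\<not> linked I U w (emb I U i) (emb I U j)"
proof -
  let ?x = "emb I U i" and ?y = "emb I U j"
  have t: "?x \<in> tree I U" "?y \<in> tree I U" and xy: "?x \<noteq> ?y"
    using emb_in_tree i j ne emb_inj by auto
  have zt: "z \<in> tree I U - V\<^sub>I" "linked I U w ?x z"
    using off_tree[OF z] off_nbrs[OF z] by (auto simp: nbrs_def)
  obtain q where q: "simple_path I U w z ?y q" "set q \<subseteq> {z, ?y} \<union> (tree I U - V\<^sub>I)"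
    using path_cond_simple_path[OF pc] zt(1) t by blast
  have q_hd: "q \<noteq> []" "hd q = z" "last q = ?y" using q(1) by (auto simp: simple_path_def)
  have "?x \<notin> set q" using q(2) xy zt i by auto
  then have p: "simple_path I U w ?x ?y (?x # q)"
    using simple_path_Cons[OF q_hd(1)] q(1) q_hd zt(2) by simp
  have first: "k = z" if "linked I U w ?x k" "k \<in> set (?x # q)" for k
    using simple_path_neighbour[OF p that(1)] that linked_neq[OF that(1)] q_hd by auto
  show "z \<in> geod I U w ?x ?y" unfolding geod_eq[OF p] using q_hd by auto
  show "linked I U w ?x k \<Longrightarrow> k \<in> geod I U w ?x ?y \<Longrightarrow> k = z"
    unfolding geod_eq[OF p] by (rule first)
  show "\<not> linked I U w ?x ?y"
  proof
    assume "linked I U w ?x ?y"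
    then have "?y = z" using first q_hd by (metis last_in_set list.set_intros(2))
    then show False using zt(1) j by auto
  qed
qed

section \<open>The Dirichlet problem off the index set\<close>

text \<open>For \<open>x\<close> off \<open>I\<close>, the probability that the jump chain makes
  \<open>n\<close> steps without meeting \<open>I\<close> or being absorbed.\<close>

primrec survive :: "nat \<Rightarrow> 'a vertex \<Rightarrow> real" where
  "survive 0 x = 1"
| "survive (Suc n) x = (\<Sum>z\<in>off x. cond x z / rate x * survive n z)"

lemma has_sum_finite_sum:
  fixes f :: "'c \<Rightarrow> 'b \<Rightarrow> real"
  assumes "finite F" "\<And>z. z \<in> F \<Longrightarrow> (f z has_sum s z) A"
  shows "((\<lambda>k. \<Sum>z\<in>F. f z k) has_sum (\<Sum>z\<in>F. s z)) A"
  using assms by (induction F) (auto intro: has_sum_add)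

lemma has_sum_emb:
  assumes "\<And>y. y \<notin> nbrs x \<Longrightarrow> g y = 0"
  shows "((\<lambda>k. g (emb I U k)) has_sum (\<Sum>y\<in>nbrs x \<inter> V\<^sub>I. g y)) I"
proof -
  have "(g has_sum (\<Sum>y\<in>nbrs x \<inter> V\<^sub>I. g y)) V\<^sub>I"
    by (rule has_sum_finite_neutralI[where B = "nbrs x \<inter> V\<^sub>I"]) (use finite_nbrs assms in auto)
  then show ?thesis
    by (subst (asm) has_sum_reindex) (auto simp: inj_on_def comp_def intro: emb_inj)
qed

lemma sum_nbrs_split:
  fixes g :: "'a vertex \<Rightarrow> 'b :: comm_monoid_add"
  shows "(\<Sum>y\<in>nbrs x. g y) = (\<Sum>y\<in>nbrs x \<inter> V\<^sub>I. g y) + (\<Sum>y\<in>off x. g y)"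
  unfolding off_def by (subst sum.union_disjoint[symmetric]) (auto simp: finite_nbrs intro: sum.cong)

text \<open>Dividing by the full \<open>rate x\<close>, which at the root includes absorption, gives
  \<open>Absorbed\<close> the boundary value 0.\<close>

lemma potential_harmonic:
  assumes x: "x \<in> tree I U - V\<^sub>I" and j: "j \<in> I"
  shows "potential j x = (\<Sum>y\<in>nbrs x \<inter> V\<^sub>I. cond x y / rate x * potential j y) +
    (\<Sum>y\<in>off x. cond x y / rate x * potential j y)"
proof -
  have "x \<noteq> emb I U j" using x j by auto
  then have "rate x * potential j x = (\<Sum>y\<in>nbrs x. cond x y * potential j y)"
    using potential_laplacian[of x j] x j by simp
  then have "potential j x = (\<Sum>y\<in>nbrs x. cond x y * potential j y) / rate x"
    using rate_pos[of x] by (simp add: field_simps)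
  then show ?thesis unfolding sum_nbrs_split by (simp add: sum_divide_distrib add_divide_distrib)
qed

text \<open>The mean value identity is iterated: neighbours in \<open>I\<close> are final, the
  others are expanded again. Thus \<open>a m\<close> collects the paths entering \<open>I\<close> at
  step \<open>m + 1\<close>, and the remainder after \<open>n\<close> rounds averages a potential
  bounded by \<open>U j j\<close> over the surviving paths.\<close>

lemma potential_expansion:
  assumes x: "x \<in> tree I U - V\<^sub>I" and j: "j \<in> I"
  shows "\<exists>a. (\<forall>m. ((\<lambda>k. path_cond m x (emb I U k) / rate x * U k j) has_sum a m) I) \<and>
    (\<forall>n. \<bar>potential j x - (\<Sum>m<n. a m)\<bar> \<le> U j j * survive n x)"
proof -
  \<comment> \<open>The recursion produces functions of the vertex, because each round evaluates the
    previous one at the neighbours.\<close>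
  define a where "a = rec_nat (\<lambda>x. \<Sum>y\<in>nbrs x \<inter> V\<^sub>I. cond x y / rate x * potential j y)
    (\<lambda>_ a x. \<Sum>z\<in>off x. cond x z / rate x * a z)"
  have a0: "a 0 x = (\<Sum>y\<in>nbrs x \<inter> V\<^sub>I. cond x y / rate x * potential j y)" for x
    by (simp add: a_def)
  have aS: "a (Suc m) x = (\<Sum>z\<in>off x. cond x z / rate x * a m z)" for m x
    by (simp add: a_def)
  have "((\<lambda>k. path_cond m x (emb I U k) / rate x * U k j) has_sum a m x) I" for m x
  proof (induction m arbitrary: x)
    case 0
    have "((\<lambda>k. cond x (emb I U k) / rate x * potential j (emb I U k)) has_sum a 0 x) I"
      unfolding a0 by (rule has_sum_emb) (simp add: cond_eq_0)
    then show ?case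
      by (subst has_sum_cong[where g = "\<lambda>k. cond x (emb I U k) / rate x * potential j (emb I U k)"])
        (simp_all add: potential_emb j)
  next
    case (Suc m)
    have "((\<lambda>k. \<Sum>z\<in>off x. cond x z / rate x * (path_cond m z (emb I U k) / rate z * U k j))
      has_sum a (Suc m) x) I"
      unfolding aS by (intro has_sum_finite_sum finite_off has_sum_cmult_right Suc.IH)
    then show ?case by (simp add: sum_distrib_left sum_distrib_right sum_divide_distrib mult_ac)
  qed
  moreover have "\<bar>potential j x - (\<Sum>m<n. a m x)\<bar> \<le> U j j * survive n x"
    if "x \<in> tree I U - V\<^sub>I" for n x
    using that
  proof (induction n arbitrary: x)
    case 0
    then show ?case using potential_bounds[of x j] j by simp
  next
    case (Suc n)
    have "potential j x - (\<Sum>m<Suc n. a m x) =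
      (\<Sum>z\<in>off x. cond x z / rate x * potential j z) - (\<Sum>m<n. a (Suc m) x)"
      unfolding potential_harmonic[OF Suc.prems j] sum.lessThan_Suc_shift a0 by simp
    also have "(\<Sum>m<n. a (Suc m) x) = (\<Sum>z\<in>off x. cond x z / rate x * (\<Sum>m<n. a m z))"
      unfolding aS sum_distrib_left by (rule sum.swap)
    also have "(\<Sum>z\<in>off x. cond x z / rate x * potential j z) - \<dots> =
      (\<Sum>z\<in>off x. cond x z / rate x * (potential j z - (\<Sum>m<n. a m z)))"
      by (simp add: right_diff_distrib sum_subtractf)
    also have "\<bar>\<dots>\<bar> \<le> (\<Sum>z\<in>off x. \<bar>cond x z / rate x * (potential j z - (\<Sum>m<n. a m z))\<bar>)"
      by (rule sum_abs)
    also have "\<dots> \<le> (\<Sum>z\<in>off x. cond x z / rate x * (U j j * survive n z))"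
    proof (rule sum_mono)
      fix z assume "z \<in> off x"
      then have "\<bar>potential j z - (\<Sum>m<n. a m z)\<bar> \<le> U j j * survive n z"
        by (intro Suc.IH off_tree)
      moreover have "0 \<le> cond x z / rate x" using cond_nonneg rate_pos[of x] by simp
      ultimately show "\<bar>cond x z / rate x * (potential j z - (\<Sum>m<n. a m z))\<bar>
          \<le> cond x z / rate x * (U j j * survive n z)"
        by (simp only: abs_mult abs_of_nonneg mult_left_mono)
    qed
    also have "\<dots> = U j j * survive (Suc n) x"
      by (simp add: sum_distrib_left mult_ac)
    finally show ?case .
  qed
  ultimately show ?thesis using x by (intro exI[of _ "\<lambda>m. a m x"]) auto
qed

text \<open>The remainder vanishes in the limit, so the \<open>a m\<close> sum to the potential.
  Nonnegativity then permits summing over the steps \<open>m\<close> first, which turns the path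
  weights into \<open>H k\<close>.\<close>

lemma potential_representation:
  assumes x: "x \<in> tree I U - V\<^sub>I" and j: "j \<in> I"
    and surv: "(\<lambda>n. survive n x) \<longlonglongrightarrow> 0"
    and H: "\<And>k. k \<in> I \<Longrightarrow> (\<lambda>m. path_cond m x (emb I U k) / rate x) sums H k"
  shows "((\<lambda>k. H k * U k j) has_sum potential j x) I"
proof -
  let ?t = "\<lambda>m k. path_cond m x (emb I U k) / rate x * U k j"
  obtain a where a: "\<And>m. (?t m has_sum a m) I"
    and bound: "\<And>n. \<bar>potential j x - (\<Sum>m<n. a m)\<bar> \<le> U j j * survive n x"
    using potential_expansion[OF x j] by blast
  have t_nonneg: "0 \<le> ?t m k" if "k \<in> I" for m k
    using that j path_cond_nonneg rate_pos[of x] U_pos[of k j] by (simp add: less_imp_le)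
  have a_nonneg: "0 \<le> a m" for m using has_sum_nonneg[OF a] t_nonneg by blast
  have "(\<lambda>n. U j j * survive n x) \<longlonglongrightarrow> 0" using tendsto_mult_right_zero[OF surv] .
  then have "(\<lambda>n. potential j x - (\<Sum>m<n. a m)) \<longlonglongrightarrow> 0"
    by (rule Lim_null_comparison[rotated]) (use bound in auto)
  then have "a sums potential j x"
    unfolding sums_def by (subst (asm) LIM_zero_iff[symmetric])
      (auto simp: tendsto_iff dist_real_def abs_minus_commute)
  then have A: "(a has_sum potential j x) UNIV" using a_nonneg by (rule sums_nonneg_imp_has_sum)
  have sm: "(\<lambda>(m, k). ?t m k) summable_on UNIV \<times> I"
    by (rule summable_on_SigmaI[where g = a]) (use a A t_nonneg in \<open>auto dest: has_sum_imp_summable\<close>)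
  then have "((\<lambda>(m, k). ?t m k) has_sum potential j x) (UNIV \<times> I)"
    by (intro has_sum_SigmaI[where g = a]) (use a A in auto)
  then have swapped: "((\<lambda>(k, m). ?t m k) has_sum potential j x) (I \<times> UNIV)"
    by (subst (asm) has_sum_swap) simp
  have inner: "((\<lambda>m. ?t m k) has_sum H k * U k j) UNIV" if "k \<in> I" for k
    by (rule sums_nonneg_imp_has_sum) (use sums_mult2[OF H[OF that]] t_nonneg[OF that] in simp_all)
  show ?thesis by (rule has_sum_SigmaD[OF swapped]) (simp only: prod.case inner)
qed

end

section \<open>The chain on the tree\<close>

locale tree_chain = ultrametric_tree I U w
  for I :: "'a set" and U :: "'a \<Rightarrow> 'a \<Rightarrow> real" and w :: "nat \<Rightarrow> real" +
  fixes P :: "'a vertex state \<Rightarrow> 'w measure"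
    and Y :: "nat \<Rightarrow> 'w \<Rightarrow> 'a vertex state" and Z :: "nat \<Rightarrow> 'w \<Rightarrow> ennreal"
  assumes chain: "minimal_chain (tree_states I U) (tree_rates I U w) P Y Z"
    and H4: "stops_surely I U P Y Z"
begin

abbreviation "states \<equiv> tree_states I U"
abbreviation "stop \<equiv> stop_set I U"
abbreviation "jump \<equiv> jump_prob (tree_rates I U w)"

text \<open>\<open>Absorbed\<close> is listed for every vertex, with jump probability 0 except at
  the root, to avoid a case distinction.\<close>

fun next_states :: "'a vertex state \<Rightarrow> 'a vertex state set" where
  "next_states (Vertex x) = insert Absorbed (Vertex ` nbrs x)"
| "next_states Absorbed = {Absorbed}"

lemma sum_next_states:
  fixes g :: "'a vertex state \<Rightarrow> real"
  shows "(\<Sum>z\<in>next_states (Vertex x). g z) = g Absorbed + (\<Sum>z\<in>nbrs x. g (Vertex z))"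
  using finite_nbrs by (simp add: sum.reindex inj_on_def image_iff)

lemma jump_Vertex: "jump (Vertex x) (Vertex y) = cond x y / rate x"
  using rate_pos[of x] tree_Q_cond[of x y] not_self_nbr[of x]
  by (auto simp: jump_prob_def rate_def cond_eq_0)

lemma jump_Absorbed: "jump (Vertex x) Absorbed = (if x = root I U w then 1 / w 0 else 0) / rate x"
  using rate_pos[of x] by (auto simp: jump_prob_def rate_def)

lemma Vertex_in_states: "Vertex x \<in> states \<longleftrightarrow> x \<in> tree I U"
  by (auto simp: tree_states_def)

lemma Vertex_in_stop: "Vertex x \<in> stop \<longleftrightarrow> x \<in> V\<^sub>I" and Absorbed_in_stop: "Absorbed \<in> stop"
  by (auto simp: stop_set_def)

lemma chain_law:
  assumes "x \<in> states"
  shows "prob_space (P x)" "Y n \<in> measurable (P x) (count_space states)"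
    "Z n \<in> borel_measurable (P x)"
    "(\<And>k. k \<le> n \<Longrightarrow> y k \<in> states \<and> 0 \<le> s k) \<Longrightarrow>
      measure (P x) {\<omega> \<in> space (P x). \<forall>k\<le>n. Y k \<omega> = y k \<and> ennreal (s k) < Z k \<omega>} =
        (if y 0 = x then 1 else 0) * (\<Prod>k<n. jump (y k) (y (Suc k))) *
        (\<Prod>k\<le>n. exp (tree_rates I U w (y k) (y k) * s k))"
  using chain assms unfolding minimal_chain_def by blast+

lemma jump_chain:
  assumes x: "x \<in> states"
  shows "finite_range_chain (P x) states jump next_states Y (\<lambda>n \<omega>. 0 < Z n \<omega>) x"
proof -
  interpret prob_space "P x" using chain_law(1)[OF x] .
  note [measurable] = chain_law(2,3)[OF x]
  show ?thesis
  proof unfold_locales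
    show "x \<in> states" by fact
    fix n show "Y n \<in> measurable (P x) (count_space states)" by measurable
    show "Measurable.pred (P x) (\<lambda>\<omega>. 0 < Z n \<omega>)" by measurable
  next
    fix y assume y: "y \<in> states"
    show "finite (next_states y)" using finite_nbrs by (cases y) auto
    show "next_states y \<subseteq> states"
      using nbrs_tree by (cases y) (auto simp: tree_states_def)
    show "(\<Sum>z\<in>next_states y. jump y z) = 1"
    proof (cases y)
      case (Vertex v)
      then have "rate v = (\<Sum>z\<in>nbrs v. cond v z) + (if v = root I U w then 1 / w 0 else 0)"
        using y rate_eq by (simp add: Vertex_in_states)
      then have "((if v = root I U w then 1 / w 0 else 0) + (\<Sum>z\<in>nbrs v. cond v z)) / rate v = 1"
        using rate_pos[of v] by simp
      then show ?thesis unfolding Vertex sum_next_states jump_Vertex jump_Absorbed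
        by (simp only: add_divide_distrib sum_divide_distrib)
    qed (simp add: jump_prob_def)
  next
    \<comment> \<open>At \<open>s k = 0\<close> the exponential factors are 1 and the event asks
      only for positive holding times.\<close>
    fix n and ys :: "nat \<Rightarrow> 'a vertex state" assume "\<And>k. k \<le> n \<Longrightarrow> ys k \<in> states"
    then show "prob {\<omega> \<in> space (P x). \<forall>k\<le>n. Y k \<omega> = ys k \<and> 0 < Z k \<omega>} =
        (if ys 0 = x then 1 else 0) * (\<Prod>k<n. jump (ys k) (ys (Suc k)))"
      using chain_law(4)[OF x, of n ys "\<lambda>_. 0"] by simp
  qed
qed

lemma countable_states: "countable states"
proof -
  have "countable (case_prod vx ` (UNIV \<times> I))"
    using ultrametric by (auto simp: ultrametric_matrix_def)
  moreover have "tree I U \<subseteq> case_prod vx ` (UNIV \<times> I)"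
  proof
    fix x assume "x \<in> tree I U"
    then obtain n i where "i \<in> I" "x = case_prod vx (n, i)" by (auto elim: tree_cases)
    then show "x \<in> case_prod vx ` (UNIV \<times> I)" by (intro image_eqI) auto
  qed
  ultimately show ?thesis unfolding tree_states_def by (auto intro: countable_subset)
qed

text \<open>Along a fixed prefix the probability that \<open>Z n\<close> exceeds \<open>m\<close>
  decays geometrically in \<open>m\<close>, and there are countably many prefixes. After an infinite
  holding time no later state would be visible.\<close>

lemma AE_holding_finite:
  assumes x: "x \<in> states"
  shows "AE \<omega> in P x. \<forall>n. Y n \<omega> \<noteq> Absorbed \<longrightarrow> Z n \<omega> < \<infinity>"
proof (subst AE_all_countable, intro allI)
  fix n
  interpret finite_range_chain "P x" states jump next_states Y "\<lambda>n \<omega>. 0 < Z n \<omega>" x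
    using jump_chain[OF x] .
  note [measurable] = chain_law(3)[OF x]
  have path: "AE \<omega> in P x. cyl n y \<omega> \<longrightarrow> y n \<noteq> Absorbed \<longrightarrow> Z n \<omega> < \<infinity>"
    if y: "y \<in> PiE {..n} (\<lambda>_. states)" for y
  proof (cases "y n")
    case (Vertex v)
    let ?E = "{\<omega> \<in> space (P x). cyl n y \<omega> \<and> Z n \<omega> = \<infinity>}"
    let ?s = "\<lambda>m k. if k = n then real m else 0"
    let ?c = "(if y 0 = x then 1 else 0) * (\<Prod>k<n. jump (y k) (y (Suc k)))"
    have "prob ?E \<le> ?c * exp (- rate v) ^ m" for m :: nat
    proof -
      have "prob ?E \<le> prob {\<omega> \<in> space (P x). \<forall>k\<le>n. Y k \<omega> = y k \<and> ennreal (?s m k) < Z k \<omega>}"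
        by (rule finite_measure_mono) (auto simp: cyl_def)
      also have "\<dots> = ?c * (\<Prod>k\<le>n. exp (tree_rates I U w (y k) (y k) * ?s m k))"
        using y by (intro chain_law(4)[OF x]) auto
      also have "(\<Prod>k\<le>n. exp (tree_rates I U w (y k) (y k) * ?s m k)) = exp (- rate v * m)"
        unfolding lessThan_Suc_atMost[symmetric] by (simp add: Vertex rate_def)
      also have "exp (- rate v * m) = exp (- rate v) ^ m"
        by (simp add: exp_of_nat_mult[symmetric] mult.commute)
      finally show ?thesis .
    qed
    moreover have "(\<lambda>m. ?c * exp (- rate v) ^ m) \<longlonglongrightarrow> ?c * 0"
      using rate_pos[of v] by (intro tendsto_intros LIMSEQ_power_zero) simp
    ultimately have "prob ?E \<le> 0"
      by (intro LIMSEQ_le_const[of "\<lambda>m. ?c * exp (- rate v) ^ m"]) auto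
    then have "prob ?E = 0" using measure_nonneg[of "P x" ?E] by linarith
    then have "AE \<omega> in P x. \<omega> \<notin> ?E"
      by (intro AE_not_in) (auto simp: null_sets_def emeasure_eq_measure)
    with AE_space show ?thesis by eventually_elim (auto simp: less_top)
  qed simp
  have "countable (PiE {..n} (\<lambda>_. states))" by (intro countable_PiE countable_states) simp
  then have "AE \<omega> in P x. \<forall>y\<in>PiE {..n} (\<lambda>_. states). cyl n y \<omega> \<longrightarrow> y n \<noteq> Absorbed \<longrightarrow> Z n \<omega> < \<infinity>"
    using path by (subst AE_ball_countable) auto
  with AE_G AE_space show "AE \<omega> in P x. Y n \<omega> \<noteq> Absorbed \<longrightarrow> Z n \<omega> < \<infinity>"
  proof eventually_elim
    case (elim \<omega>)
    have "Y k \<omega> \<in> states" for k using elim(2) Y_measurable[of k] by (auto simp: measurable_def)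
    then have "restrict (\<lambda>k. Y k \<omega>) {..n} \<in> PiE {..n} (\<lambda>_. states)" by auto
    moreover have "cyl n (restrict (\<lambda>k. Y k \<omega>) {..n}) \<omega>" using elim(1) by (auto simp: cyl_def)
    ultimately show ?case using elim(3) by fastforce
  qed
qed

lemma stopped_measurable:
  assumes x: "x \<in> states"
  shows "{\<omega> \<in> space (P x). stopped_value I U Y Z \<omega> \<in> Some ` C} \<in> sets (P x)"
proof -
  interpret finite_range_chain "P x" states jump next_states Y "\<lambda>n \<omega>. 0 < Z n \<omega>" x
    using jump_chain[OF x] .
  note [measurable] = chain_law(3)[OF x]
  show ?thesis unfolding stopped_value_def chain_at_hitting_time_in by measurable
qed

text \<open>Positive holding times make a state visible once it is reached at a finite time. Only
  the holding times before the first entrance matter, so explosion does no harm.\<close>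

lemma AE_stopped:
  assumes x: "x \<in> states"
  shows "AE \<omega> in P x. stopped_value I U Y Z \<omega> \<in> Some ` C \<longleftrightarrow>
    (\<exists>n. Y n \<omega> \<in> stop \<inter> C \<and> (\<forall>m<n. Y m \<omega> \<notin> stop))"
proof -
  interpret finite_range_chain "P x" states jump next_states Y "\<lambda>n \<omega>. 0 < Z n \<omega>" x
    using jump_chain[OF x] .
  from AE_G AE_holding_finite[OF x] show ?thesis
  proof eventually_elim
    case (elim \<omega>)
    let ?S = "\<lambda>n. \<Sum>k<n. Z k \<omega>"
    have step: "?S n < ?S (Suc n)" if "\<And>m. m < n \<Longrightarrow> Z m \<omega> < \<infinity>" for n
    proof -
      have "?S n \<noteq> top" using that by (auto simp: less_top[symmetric])
      then have "?S n + 0 < ?S n + Z n \<omega>"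
        using elim(1) by (simp only: ennreal_add_left_cancel_less) simp
      then show ?thesis by simp
    qed
    show ?case unfolding stopped_value_def chain_at_hitting_time_in
    proof (intro iffI; elim exE conjE)
      fix n assume n: "Y n \<omega> \<in> stop \<inter> C" "?S n < ?S (Suc n)"
        "\<forall>m<n. \<not> (Y m \<omega> \<in> stop \<and> ?S m < ?S (Suc m))"
      \<comment> \<open>The strict increase at \<open>n\<close> already forces all earlier holding
        times to be finite.\<close>
      have "?S n < \<infinity>" using n(2) by (auto simp: less_top)
      then have "Z m \<omega> < \<infinity>" if "m < n" for m using that by (auto simp: less_top)
      then have "?S m < ?S (Suc m)" if "m < n" for m using that by (intro step) auto
      with n show "\<exists>n. Y n \<omega> \<in> stop \<inter> C \<and> (\<forall>m<n. Y m \<omega> \<notin> stop)" by blast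
    next
      fix n assume n: "Y n \<omega> \<in> stop \<inter> C" "\<forall>m<n. Y m \<omega> \<notin> stop"
      \<comment> \<open>\<open>Absorbed\<close> belongs to \<open>stop\<close>, so it has not been
        visited before \<open>n\<close>.\<close>
      then have "Z m \<omega> < \<infinity>" if "m < n" for m
        using that elim(2) Absorbed_in_stop by metis
      then have "?S n < ?S (Suc n)" by (rule step)
      with n show "\<exists>n. Y n \<omega> \<in> stop \<inter> C \<and> ?S n < ?S (Suc n) \<and>
        (\<forall>m<n. \<not> (Y m \<omega> \<in> stop \<and> ?S m < ?S (Suc m)))" by blast
    qed
  qed
qed

lemma sum_next_off:
  assumes "\<And>z. z \<in> stop \<Longrightarrow> g z = 0"
  shows "(\<Sum>z\<in>next_states (Vertex x). jump (Vertex x) z * g z) =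
    (\<Sum>z\<in>off x. cond x z / rate x * g (Vertex z))"
  unfolding sum_next_states sum_nbrs_split jump_Vertex
  using assms by (auto simp: Vertex_in_stop Absorbed_in_stop intro!: sum.neutral)

lemma survive_prob:
  assumes k: "k \<in> tree I U - V\<^sub>I"
  shows "measure (P (Vertex k)) {\<omega> \<in> space (P (Vertex k)). \<forall>m\<le>n. Y m \<omega> \<notin> stop} = survive n k"
proof -
  interpret finite_range_chain "P (Vertex k)" states jump next_states Y "\<lambda>n \<omega>. 0 < Z n \<omega>" "Vertex k"
    using jump_chain k by (simp add: Vertex_in_states)
  have "path_weight n (\<lambda>_. - stop) (Vertex x) = survive n x" if "x \<in> tree I U - V\<^sub>I" for x
    using that
  proof (induction n arbitrary: x)
    case 0
    then show ?case by (simp add: Vertex_in_stop)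
  next
    case (Suc n)
    have "path_weight n (\<lambda>_. - stop) z = 0" if "z \<in> stop" for z
      using that by (cases n) auto
    then have "path_weight (Suc n) (\<lambda>_. - stop) (Vertex x) =
        (\<Sum>z\<in>off x. cond x z / rate x * path_weight n (\<lambda>_. - stop) (Vertex z))"
      using Suc.prems by (simp only: path_weight.simps sum_next_off) (simp add: Vertex_in_stop)
    then show ?case using Suc.IH off_tree by simp
  qed
  then show ?thesis using prob_path[of n "\<lambda>_. - stop"] k by simp
qed

text \<open>The index shifts because \<open>path_cond n\<close> has \<open>n + 1\<close> steps; the
  factor \<open>1 / rate k\<close> is the normalization of the first step, omitted in
  \<open>path_cond\<close>.\<close>

lemma first_hit_prob:
  assumes k: "k \<in> tree I U - V\<^sub>I" and y: "y \<in> V\<^sub>I"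
  shows "measure (P (Vertex k)) {\<omega> \<in> space (P (Vertex k)).
      Y (Suc n) \<omega> = Vertex y \<and> (\<forall>m<Suc n. Y m \<omega> \<notin> stop)} = path_cond n k y / rate k"
proof -
  interpret finite_range_chain "P (Vertex k)" states jump next_states Y "\<lambda>n \<omega>. 0 < Z n \<omega>" "Vertex k"
    using jump_chain k by (simp add: Vertex_in_states)
  let ?S = "\<lambda>n m. if m < n then - stop else {Vertex y}"
  have shift: "(\<lambda>m. ?S (Suc n) (Suc m)) = ?S n" for n by auto
  have "path_weight (Suc n) (?S (Suc n)) (Vertex x) = path_cond n x y / rate x"
    if "x \<in> tree I U - V\<^sub>I" for x
    using that
  proof (induction n arbitrary: x)
    case 0
    have "path_weight (Suc 0) (?S (Suc 0)) (Vertex x) =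
      (\<Sum>z\<in>next_states (Vertex x). jump (Vertex x) z * indicator {Vertex y} z)"
      using 0 by (simp add: Vertex_in_stop)
    also have "\<dots> = (\<Sum>z\<in>nbrs x. if z = y then cond x z / rate x else 0)"
      unfolding sum_next_states jump_Vertex by (auto simp: indicator_def intro!: sum.cong)
    also have "\<dots> = cond x y / rate x" using finite_nbrs cond_eq_0 by simp
    finally show ?case by simp
  next
    case (Suc n)
    have "path_weight (Suc n) (?S (Suc n)) z = 0" if "z \<in> stop" for z using that by simp
    then have "path_weight (Suc (Suc n)) (?S (Suc (Suc n))) (Vertex x) =
        (\<Sum>z\<in>off x. cond x z / rate x * path_weight (Suc n) (?S (Suc n)) (Vertex z))"
      using Suc.prems
      by (simp only: path_weight.simps(2)[of "Suc n"] shift sum_next_off) (simp add: Vertex_in_stop)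
    also have "\<dots> = (\<Sum>z\<in>off x. cond x z / rate x * (path_cond n z y / rate z))"
      using Suc.IH off_tree by (intro sum.cong) auto
    finally show ?case by (simp add: sum_divide_distrib mult_ac)
  qed
  moreover have "{\<omega> \<in> space (P (Vertex k)). Y (Suc n) \<omega> = Vertex y \<and> (\<forall>m<Suc n. Y m \<omega> \<notin> stop)} =
    {\<omega> \<in> space (P (Vertex k)). \<forall>m\<le>Suc n. Y m \<omega> \<in> ?S (Suc n) m}"
    by (auto simp: le_less)
  ultimately show ?thesis using prob_path[of "Suc n" "?S (Suc n)"] k by simp
qed

text \<open>By (H4) the event of never meeting \<open>stop\<close> is null, and it is the decreasing
  limit of the survival events.\<close>

lemma survive_tendsto_0:
  assumes k: "k \<in> tree I U - V\<^sub>I" shows "(\<lambda>n. survive n k) \<longlonglongrightarrow> 0"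
proof -
  have x: "Vertex k \<in> states" using k by (simp add: Vertex_in_states)
  interpret finite_range_chain "P (Vertex k)" states jump next_states Y "\<lambda>n \<omega>. 0 < Z n \<omega>" "Vertex k"
    using jump_chain[OF x] .
  let ?D = "\<lambda>n. {\<omega> \<in> space (P (Vertex k)). \<forall>m\<le>n. Y m \<omega> \<notin> stop}"
  have "prob {\<omega> \<in> space (P (Vertex k)). stopped_value I U Y Z \<omega> \<in> Some ` stop} = 1"
    using H4 k by (auto simp: stops_surely_def)
  then have "AE \<omega> in P (Vertex k). stopped_value I U Y Z \<omega> \<in> Some ` stop"
    using stopped_measurable[OF x] by (intro AE_I_eq_1) (auto simp: emeasure_eq_measure)
  with AE_stopped[OF x, of stop] have "AE \<omega> in P (Vertex k). \<omega> \<notin> (\<Inter>n. ?D n)"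
    by eventually_elim auto
  moreover have "(\<Inter>n. ?D n) \<in> sets (P (Vertex k))" by measurable
  ultimately have "prob (\<Inter>n. ?D n) = 0" by (simp only: prob_eq_0)
  moreover have "(\<lambda>n. prob (?D n)) \<longlonglongrightarrow> prob (\<Inter>n. ?D n)"
    by (rule finite_Lim_measure_decseq) (auto simp: decseq_def)
  ultimately show ?thesis using survive_prob[OF k] by simp
qed

section \<open>Hitting probabilities and the matrix on the index set\<close>

abbreviation "hp \<equiv> hit_prob I U P Y Z"

text \<open>The hitting event is split by the number of the jump that first meets
  \<open>stop\<close>. Jump number 0 contributes nothing since \<open>k\<close> is off
  \<open>I\<close>.\<close>

lemma hit_prob_sums:
  assumes k: "k \<in> tree I U - V\<^sub>I" and j: "j \<in> I"
  shows "(\<lambda>n. path_cond n k (emb I U j) / rate k) sums hp k j"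
proof -
  have x: "Vertex k \<in> states" using k by (simp add: Vertex_in_states)
  interpret finite_range_chain "P (Vertex k)" states jump next_states Y "\<lambda>n \<omega>. 0 < Z n \<omega>" "Vertex k"
    using jump_chain[OF x] .
  let ?v = "Vertex (emb I U j)"
  let ?E = "\<lambda>n. {\<omega> \<in> space (P (Vertex k)). Y n \<omega> = ?v \<and> (\<forall>m<n. Y m \<omega> \<notin> stop)}"
  have v: "?v \<in> stop" using j by (simp add: Vertex_in_stop)
  have "(\<lambda>n. prob (?E n)) sums prob (\<Union>n. ?E n)"
  proof (rule finite_measure_UNION)
    show "range ?E \<subseteq> events" by auto
    show "disjoint_family ?E"
      unfolding disjoint_family_on_def using v
      by (auto simp: disjoint_iff) (metis linorder_neqE_nat)
  qed
  moreover have "prob (?E 0) = 0"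
  proof -
    have "prob (?E 0) = prob {}"
    proof (rule finite_measure_eq_AE)
      show "AE \<omega> in P (Vertex k). (\<omega> \<in> ?E 0) = (\<omega> \<in> {})"
        using AE_start by eventually_elim (use k j in auto)
    qed auto
    then show ?thesis by simp
  qed
  ultimately have "(\<lambda>n. prob (?E (Suc n))) sums prob (\<Union>n. ?E n)"
    by (intro sums_Suc_iff[where f = "\<lambda>n. prob (?E n)", THEN iffD2]) (simp only: add_0_right)
  moreover have "prob (\<Union>n. ?E n) = hp k j"
    unfolding hit_prob_def
  proof (rule finite_measure_eq_AE)
    show "AE \<omega> in P (Vertex k). (\<omega> \<in> (\<Union>n. ?E n)) =
        (\<omega> \<in> {\<omega> \<in> space (P (Vertex k)). stopped_value I U Y Z \<omega> = Some ?v})"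
      using AE_stopped[OF x, of "{?v}"] AE_space by eventually_elim (use v in auto)
    show "{\<omega> \<in> space (P (Vertex k)). stopped_value I U Y Z \<omega> = Some ?v} \<in> events"
      using stopped_measurable[OF x, of "{?v}"] by simp
  qed auto
  moreover have "prob (?E (Suc n)) = path_cond n k (emb I U j) / rate k" for n
    using first_hit_prob[OF k] j by blast
  ultimately show ?thesis by simp
qed

text \<open>The asserted formula as a finite sum: off \<open>I\<close> the row of the tree matrix
  lives on the neighbours and equals \<open>cond\<close>.\<close>

definition Q :: "'a \<Rightarrow> 'a \<Rightarrow> real" where
  "Q i j = tree_Q I U w (emb I U i) (emb I U j) +
    (\<Sum>z\<in>off (emb I U i). cond (emb I U i) z * hp z j)"

text \<open>The term of index 0 is the direct edge; the terms of index \<open>Suc n\<close> come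
  from expanding the hitting probabilities.\<close>

lemma Q_sums:
  assumes i: "i \<in> I" and j: "j \<in> I" and ne: "i \<noteq> j"
  shows "(\<lambda>n. path_cond n (emb I U i) (emb I U j)) sums Q i j"
proof -
  let ?x = "emb I U i" and ?y = "emb I U j"
  have "(\<lambda>n. \<Sum>z\<in>off ?x. cond ?x z * (path_cond n z ?y / rate z)) sums
      (\<Sum>z\<in>off ?x. cond ?x z * hp z j)"
    by (intro sums_sum sums_mult hit_prob_sums off_tree j)
  then have "(\<lambda>n. path_cond (Suc n) ?x ?y) sums (\<Sum>z\<in>off ?x. cond ?x z * hp z j)"
    by simp
  then have "(\<lambda>n. path_cond n ?x ?y) sums ((\<Sum>z\<in>off ?x. cond ?x z * hp z j) + path_cond 0 ?x ?y)"
    by (rule sums_Suc_iff[THEN iffD1])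
  moreover have "tree_Q I U w ?x ?y = path_cond 0 ?x ?y"
    using tree_Q_cond[of ?x ?y] emb_inj[OF i j] ne by auto
  ultimately show ?thesis unfolding Q_def by (simp only: add.commute)
qed

lemma Q_sym: "i \<in> I \<Longrightarrow> j \<in> I \<Longrightarrow> Q i j = Q j i"
  using Q_sums[of i j] Q_sums[of j i] path_cond_sym[of _ "emb I U i" "emb I U j"]
  by (cases "i = j") (auto dest: sums_unique2)

lemma Q_nonneg: "i \<in> I \<Longrightarrow> j \<in> I \<Longrightarrow> i \<noteq> j \<Longrightarrow> 0 \<le> Q i j"
  by (rule sums_le[OF _ sums_zero Q_sums]) (rule path_cond_nonneg)

lemma Q_eq_0_iff:
  assumes "i \<in> I" "j \<in> I" "i \<noteq> j" shows "Q i j \<noteq> 0 \<longleftrightarrow> j \<in> U_neighbours I U w i"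
proof -
  have "Q i j = 0 \<longleftrightarrow> (\<forall>n. path_cond n (emb I U i) (emb I U j) = 0)"
    unfolding sums_unique[OF Q_sums[OF assms]]
    by (rule suminf_eq_zero_iff[OF sums_summable[OF Q_sums[OF assms]]]) (rule path_cond_nonneg)
  then show ?thesis using U_neighbours_iff assms by blast
qed

lemma hp_nonzero:
  assumes "k \<in> tree I U - V\<^sub>I" "j \<in> I" "hp k j \<noteq> 0"
  shows "\<exists>n. path_cond n k (emb I U j) \<noteq> 0"
proof (rule ccontr)
  assume "\<not> ?thesis"
  then have "(\<lambda>n. 0) sums hp k j" using hit_prob_sums[OF assms(1,2)] by simp
  then show False using assms(3) sums_unique2 sums_zero by blast
qed

text \<open>The sum over \<open>k\<close> splits into the diagonal, the neighbours in
  \<open>I\<close> and the excursions. \<open>potential_representation\<close> collapses the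
  excursions through \<open>z\<close> to \<open>potential j z\<close>, and the total is the tree
  Laplacian at the image of \<open>i\<close>.\<close>

lemma Q_U:
  assumes i: "i \<in> I" and j: "j \<in> I"
  shows "((\<lambda>k. Q i k * U k j) has_sum (if i = j then - 1 else 0)) I"
proof -
  let ?x = "emb I U i"
  have tQ: "tree_Q I U w ?x (emb I U k) * U k j =
      (if k = i then - rate ?x * U i j else 0) + cond ?x (emb I U k) * potential j (emb I U k)"
    if k: "k \<in> I" for k
  proof (cases "k = i")
    case True
    then show ?thesis using cond_eq_0[OF not_self_nbr[of ?x]] by (simp add: rate_def)
  next
    case False
    then show ?thesis using tree_Q_cond[of ?x "emb I U k"] emb_inj[OF i k] potential_emb[OF k j]
      by auto
  qed
  have "((\<lambda>k. if k = i then - rate ?x * U i j else 0) has_sum - rate ?x * U i j) I"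
    by (rule has_sum_finite_neutralI[where B = "{i}"]) (use i in auto)
  moreover have "((\<lambda>k. cond ?x (emb I U k) * potential j (emb I U k)) has_sum
      (\<Sum>y\<in>nbrs ?x \<inter> V\<^sub>I. cond ?x y * potential j y)) I"
    by (rule has_sum_emb) (simp add: cond_eq_0)
  moreover have "((\<lambda>k. \<Sum>z\<in>off ?x. cond ?x z * (hp z k * U k j)) has_sum
      (\<Sum>z\<in>off ?x. cond ?x z * potential j z)) I"
    by (intro has_sum_finite_sum finite_off has_sum_cmult_right potential_representation
        survive_tendsto_0 hit_prob_sums off_tree j)
  ultimately have "((\<lambda>k. (if k = i then - rate ?x * U i j else 0) +
        cond ?x (emb I U k) * potential j (emb I U k) +
        (\<Sum>z\<in>off ?x. cond ?x z * (hp z k * U k j))) has_sum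
      - rate ?x * U i j + (\<Sum>y\<in>nbrs ?x \<inter> V\<^sub>I. cond ?x y * potential j y) +
        (\<Sum>z\<in>off ?x. cond ?x z * potential j z)) I"
    by (intro has_sum_add)
  also have "- rate ?x * U i j + (\<Sum>y\<in>nbrs ?x \<inter> V\<^sub>I. cond ?x y * potential j y) +
      (\<Sum>z\<in>off ?x. cond ?x z * potential j z) = (if i = j then - 1 else 0)"
    using potential_laplacian[OF emb_in_tree[OF i] j] potential_emb[OF i j] emb_eq_iff[OF i j]
    unfolding sum_nbrs_split by simp
  finally have *: "((\<lambda>k. (if k = i then - rate ?x * U i j else 0) +
        cond ?x (emb I U k) * potential j (emb I U k) +
        (\<Sum>z\<in>off ?x. cond ?x z * (hp z k * U k j))) has_sum (if i = j then - 1 else 0)) I" .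
  have "Q i k * U k j = (if k = i then - rate ?x * U i j else 0) +
        cond ?x (emb I U k) * potential j (emb I U k) +
        (\<Sum>z\<in>off ?x. cond ?x z * (hp z k * U k j))" if "k \<in> I" for k
    unfolding Q_def distrib_right tQ[OF that] by (simp add: sum_distrib_right mult.assoc)
  with * show ?thesis by (simp cong: has_sum_cong)
qed

lemma U_Q:
  assumes i: "i \<in> I" and j: "j \<in> I"
  shows "((\<lambda>k. U i k * Q k j) has_sum (if i = j then - 1 else 0)) I"
proof -
  have "U i k * Q k j = Q j k * U k i" if "k \<in> I" for k
    using that U_sym[OF i that] Q_sym[OF j that] by simp
  then have "((\<lambda>k. U i k * Q k j) has_sum (if j = i then - 1 else 0)) I"
    using Q_U[OF j i] by (simp cong: has_sum_cong)
  then show ?thesis by (simp only: eq_commute[of i j])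
qed

text \<open>With \<open>Q i i\<close> nonnegative the whole row would be nonnegative, hence also the
  diagonal entry of \<open>Q U\<close>, which is \<open>- 1\<close>. No return probability has to be
  computed.\<close>

lemma Q_diag_neg:
  assumes i: "i \<in> I" shows "Q i i < 0"
proof (rule ccontr)
  assume "\<not> Q i i < 0"
  then have "0 \<le> Q i k" if "k \<in> I" for k using Q_nonneg[OF i that] by (cases "i = k") auto
  then have "0 \<le> Q i k * U k i" if "k \<in> I" for k using that U_pos[OF that i] by simp
  then have "0 \<le> (if i = i then - 1 else 0 :: real)" by (rule has_sum_nonneg[OF Q_U[OF i i]])
  then show False by simp
qed

lemma Q_formula:
  assumes i: "i \<in> I"
  shows "((\<lambda>k. tree_Q I U w (emb I U i) k * hp k j) has_sum
    (Q i j - tree_Q I U w (emb I U i) (emb I U j))) (tree I U - V\<^sub>I)"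
proof (rule has_sum_finite_neutralI[OF finite_off[of "emb I U i"]])
  let ?x = "emb I U i"
  have tQ: "tree_Q I U w ?x k = cond ?x k" if "k \<notin> V\<^sub>I" for k
    using tree_Q_cond[of ?x k] that i by auto
  show "off ?x \<subseteq> tree I U - V\<^sub>I" using off_tree by blast
  show "tree_Q I U w ?x k * hp k j = 0" if "k \<in> tree I U - V\<^sub>I - off ?x" for k
    using that tQ[of k] cond_eq_0[of k ?x] by (auto simp: off_def)
  show "Q i j - tree_Q I U w ?x (emb I U j) = (\<Sum>k\<in>off ?x. tree_Q I U w ?x k * hp k j)"
    unfolding Q_def using tQ by (auto simp: off_def intro!: sum.cong)
qed

lemma Q_linked:
  assumes "i \<in> I" "j \<in> I" "i \<noteq> j" "linked I U w (emb I U i) (emb I U j)"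
  shows "Q i j = tree_Q I U w (emb I U i) (emb I U j)"
proof -
  have "hp z j = 0" if "z \<in> off (emb I U i)" for z
    using excursion_geod(3)[OF assms(1-3) that] hp_nonzero[OF off_tree[OF that] assms(2)] assms(4)
    by blast
  then show ?thesis by (simp add: Q_def)
qed

text \<open>The direct term is 0 while \<open>Q i j\<close> is not, so some excursion term is
  nonzero. Its first vertex is the second vertex of the geodesic, which leaves just this one
  term.\<close>

lemma Q_not_linked:
  assumes i: "i \<in> I" and j: "j \<in> I" and ne: "i \<noteq> j"
    and nl: "\<not> linked I U w (emb I U i) (emb I U j)" and nb: "j \<in> U_neighbours I U w i"
  shows "\<exists>k \<in> tree I U - V\<^sub>I.
    linked I U w (emb I U i) k \<and> k \<in> geod I U w (emb I U i) (emb I U j) \<and>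
    (\<forall>k'. linked I U w (emb I U i) k' \<and> k' \<in> geod I U w (emb I U i) (emb I U j) \<longrightarrow> k' = k) \<and>
    Q i j = tree_Q I U w (emb I U i) k * hp k j"
proof -
  let ?x = "emb I U i" and ?y = "emb I U j"
  have xy: "?x \<noteq> ?y" using emb_inj[OF i j] ne by blast
  have Q: "Q i j = (\<Sum>z\<in>off ?x. cond ?x z * hp z j)"
    unfolding Q_def using tree_Q_cond[OF xy] nl by (simp add: cond_def)
  moreover have "Q i j \<noteq> 0" using Q_eq_0_iff[OF i j ne] nb by blast
  ultimately obtain z where z: "z \<in> off ?x" and hz: "hp z j \<noteq> 0"
    by (metis (no_types, lifting) mult_zero_right sum.neutral)
  obtain n where n: "path_cond n z ?y \<noteq> 0" using hp_nonzero[OF off_tree[OF z] j hz] by blast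
  have l: "linked I U w ?x z" using off_nbrs[OF z] by (simp add: nbrs_def)
  have uniq: "k' = z" if "linked I U w ?x k'" "k' \<in> geod I U w ?x ?y" for k'
    using excursion_geod(2)[OF i j ne z n that] .
  have "hp z' j = 0" if "z' \<in> off ?x" "z' \<noteq> z" for z'
    using hp_nonzero[OF off_tree[OF that(1)] j] excursion_geod(1)[OF i j ne that(1)]
      uniq[of z'] that off_nbrs[OF that(1)] by (auto simp: nbrs_def)
  then have "Q i j = cond ?x z * hp z j"
    unfolding Q by (subst sum.remove[OF finite_off z]) (auto intro!: sum.neutral)
  then have "Q i j = tree_Q I U w ?x z * hp z j" using tree_Q_cond linked_neq[OF l] by simp
  then show ?thesis
    using off_tree[OF z] l excursion_geod(1)[OF i j ne z n] uniq by blast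
qed

end

theorem theorem5p1:
  fixes I :: "'a set" and U :: "'a \<Rightarrow> 'a \<Rightarrow> real" and w :: "nat \<Rightarrow> real"
    and P :: "'a vertex state \<Rightarrow> 'w measure"
    and Y :: "nat \<Rightarrow> 'w \<Rightarrow> 'a vertex state" and Z :: "nat \<Rightarrow> 'w \<Rightarrow> ennreal"
  assumes "ultrametric_matrix I U"
    and H1: "distinct_rows I U"
    and H2: "discrete_weights I U w"
    and H3: "finite_classes I U"
    and chain: "minimal_chain (tree_states I U) (tree_rates I U w) P Y Z"
    and transience: "transient I U w P Y Z"
    and H4: "stops_surely I U P Y Z"
  shows "\<exists>Q :: 'a \<Rightarrow> 'a \<Rightarrow> real.
    (\<forall>i\<in>I. \<forall>j\<in>I. ((\<lambda>k. Q i k * U k j) has_sum (if i = j then - 1 else 0)) I) \<and>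
    (\<forall>i\<in>I. \<forall>j\<in>I. ((\<lambda>k. U i k * Q k j) has_sum (if i = j then - 1 else 0)) I) \<and>
    (\<forall>i\<in>I. \<forall>j\<in>I. Q i j \<noteq> 0 \<longleftrightarrow> j \<in> insert i (U_neighbours I U w i)) \<and>
    (\<forall>i\<in>I. \<forall>j\<in>I.
       (\<lambda>k. tree_Q I U w (emb I U i) k * hit_prob I U P Y Z k j)
         summable_on (tree I U - emb I U ` I) \<and>
       Q i j = tree_Q I U w (emb I U i) (emb I U j) +
         (\<Sum>\<^sub>\<infinity>k\<in>tree I U - emb I U ` I.
            tree_Q I U w (emb I U i) k * hit_prob I U P Y Z k j)) \<and>
    (\<forall>i\<in>I. \<forall>j\<in>I. i \<noteq> j \<and> linked I U w (emb I U i) (emb I U j) \<longrightarrow>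
       Q i j = tree_Q I U w (emb I U i) (emb I U j)) \<and>
    (\<forall>i\<in>I. \<forall>j\<in>I. i \<noteq> j \<and> \<not> linked I U w (emb I U i) (emb I U j) \<and>
         j \<in> insert i (U_neighbours I U w i) \<longrightarrow>
       (\<exists>k \<in> tree I U - emb I U ` I.
          linked I U w (emb I U i) k \<and> k \<in> geod I U w (emb I U i) (emb I U j) \<and>
          (\<forall>k'. linked I U w (emb I U i) k' \<and> k' \<in> geod I U w (emb I U i) (emb I U j)
             \<longrightarrow> k' = k) \<and>
          Q i j = tree_Q I U w (emb I U i) k * hit_prob I U P Y Z k j))"
proof -
  interpret tree_chain I U w P Y Z
    using assms by unfold_locales auto
  have neigh: "Q i j \<noteq> 0 \<longleftrightarrow> j \<in> insert i (U_neighbours I U w i)" if "i \<in> I" "j \<in> I" for i j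
    using Q_eq_0_iff[OF that] Q_diag_neg[OF that(1)] by (cases "i = j") auto
  have formula: "(\<lambda>k. tree_Q I U w (emb I U i) k * hp k j) summable_on (tree I U - V\<^sub>I) \<and>
      Q i j = tree_Q I U w (emb I U i) (emb I U j) +
        (\<Sum>\<^sub>\<infinity>k\<in>tree I U - V\<^sub>I. tree_Q I U w (emb I U i) k * hp k j)" if "i \<in> I" for i j
    using Q_formula[OF that, of j] by (auto simp: infsumI dest: has_sum_imp_summable)
  have far: "\<exists>k \<in> tree I U - V\<^sub>I.
      linked I U w (emb I U i) k \<and> k \<in> geod I U w (emb I U i) (emb I U j) \<and>
      (\<forall>k'. linked I U w (emb I U i) k' \<and> k' \<in> geod I U w (emb I U i) (emb I U j) \<longrightarrow> k' = k) \<and>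
      Q i j = tree_Q I U w (emb I U i) k * hp k j"
    if "i \<in> I" "j \<in> I" "i \<noteq> j \<and> \<not> linked I U w (emb I U i) (emb I U j) \<and>
      j \<in> insert i (U_neighbours I U w i)" for i j
    using Q_not_linked[of i j] that by blast
  show ?thesis
    by (intro exI[of _ Q] conjI ballI impI)
      (use Q_U U_Q neigh formula Q_linked far in \<open>blast+\<close>)
qed

end
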